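(* Let $L$ be a lattice, $h_2=\frac14g_2(L)$, $h_3=\frac14g_3(L)$, let $m$ be a positive integer and $u\in\mathbb C\setminus L$ with $mu\in L$. Then $m\cdot\wp(u;L)$ is integral over the ring $\mathbb Z[h_2,h_3]$ (i.e. a root of a monic polynomial with coefficients in $\mathbb Z[h_2,h_3]$). If moreover $m$ is even, then $\frac m2\cdot\wp(u;L)$ is integral over $\mathbb Z[h_2,h_3]$.
   Context: For a lattice $L$: $g_2(L)=60\sum_{\omega\in L\setminus\{0\}}\omega^{-4}$, $g_3(L)=140\sum_{\omega\in L\setminus\{0\}}\omega^{-6}$, $\wp(z;L)=\frac1{z^2}+\sum_{\omega\in L\setminus\{0\}}\left(\frac1{(z-\omega)^2}-\frac1{\omega^2}\right)$. *)

theory Defs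
  imports "HOL-Analysis.Analysis" "HOL-Computational_Algebra.Polynomial"
begin

definition lattice_of :: "complex \<Rightarrow> complex \<Rightarrow> complex set" where
  "lattice_of w1 w2 = {of_int a * w1 + of_int b * w2 | a b :: int. True}"

definition is_lattice :: "complex set \<Rightarrow> bool" where
  "is_lattice L \<longleftrightarrow> (\<exists>w1 w2. Im (w2 / w1) \<noteq> 0 \<and> L = lattice_of w1 w2)"

definition g2 :: "complex set \<Rightarrow> complex" where
  "g2 L = 60 * infsum (\<lambda>w. 1 / w ^ 4) (L - {0})"

definition g3 :: "complex set \<Rightarrow> complex" where
  "g3 L = 140 * infsum (\<lambda>w. 1 / w ^ 6) (L - {0})"

definition wp :: "complex set \<Rightarrow> complex \<Rightarrow> complex" where
  "wp L z = 1 / z ^ 2 + infsum (\<lambda>w. 1 / (z - w) ^ 2 - 1 / w ^ 2) (L - {0})"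

definition int_poly2_ring :: "complex \<Rightarrow> complex \<Rightarrow> complex set" where
  "int_poly2_ring a b =
     {x. \<exists>(N::nat) (c::nat \<Rightarrow> nat \<Rightarrow> int).
           x = (\<Sum>i<N. \<Sum>j<N. of_int (c i j) * a ^ i * b ^ j)}"

definition integral_over :: "complex set \<Rightarrow> complex \<Rightarrow> bool" where
  "integral_over R x \<longleftrightarrow>
     (\<exists>p :: complex poly. lead_coeff p = 1 \<and> (\<forall>i. coeff p i \<in> R) \<and> poly p x = 0)"

end

theory Submission
  imports Defs "HOL-Complex_Analysis.Complex_Analysis"
begin

text \<open>
  Put $h_2 = g_2/4$, $h_3 = g_3/4$, so that $(\wp'/2)^2 = \wp^3 - h_2\wp - h_3$. Let $N$ be the exact
  order of $u$ modulo $L$. The recursion $W_{n+1} W_{n-1} = (\wp(u) - \wp(nu)) W_n^2$ with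
  $W_1 = 1$, $W_2 = \wp'(u)$ defines numbers $W_n$ for $n \le N$ that vanish for the first time at
  $n = N$. They are the values of the division polynomials at $u$ (up to sign), but neither
  the sigma function nor the divisors of elliptic functions are needed: by the addition theorem
  $(\wp(a+b) - \wp(c)) (\wp(a-b) - \wp(c)) (\wp(a) - \wp(b))^2$ is symmetric in $a, b, c$, and
  this symmetry alone gives $W_{p+q} W_{p-q} = (\wp(qu) - \wp(pu)) W_p^2 W_q^2$ by induction on $q$.
  The usual duplication recursions follow, and with them $W_n$ (respectively $W_n/\wp'(u)$, for even
  $n$) is a polynomial in $\wp(u)$ over $\mathbb{Z}[h_2,h_3]$ with leading coefficient $n$
  (respectively $n/2$). Now $W_N = 0$ makes $N \wp(u)$, respectively $(N/2) \wp(u)$, integral.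
\<close>

section \<open>The coefficient ring\<close>

text \<open>The analytic part has to do without counting zeros. The addition theorem is stated with
  its denominators cleared, so the difference of its two sides can be singular only on L and -b + L,
  wherever the zeros of wp(z) - wp(b) may lie, and Liouville's theorem applies. Only afterwards is
  it deduced that, off L, wp(a) = wp(b) forces a + b or a - b into L. This makes W_n nonzero for 0 <
  n < N, so the divisions in the recursion are legitimate. The recursion needs the exact order N
  because it breaks down after its first zero. Passing from N to m is pure divisibility: the leading
  coefficient divides m, and for even m also m/2, since N/2 divides m/2 when N is even, and an odd N
  dividing an even m divides m/2. Order 2 is treated apart: there wp'(u) = 0, so wp(u) itself is a
  root of the monic cubic.\<close>

lemma int_poly2_ring_monomial: "of_int c * a ^ i * b ^ j \<in> int_poly2_ring a b"
proof -
  define N where "N = Suc (i + j)"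
  have "(\<Sum>k<N. \<Sum>l<N. of_int (if k = i \<and> l = j then c else 0) * a ^ k * b ^ l)
      = (\<Sum>k<N. if k = i then (\<Sum>l<N. if l = j then of_int c * a ^ i * b ^ j else 0) else 0)"
  proof (intro sum.cong refl)
    fix k
    have "(\<Sum>l<N. of_int (if k = i \<and> l = j then c else 0) * a ^ k * b ^ l)
        = (\<Sum>l<N. if l = j then (if k = i then of_int c * a ^ i * b ^ j else 0) else 0)"
      by (intro sum.cong refl) simp
    then show "(\<Sum>l<N. of_int (if k = i \<and> l = j then c else 0) * a ^ k * b ^ l)
        = (if k = i then (\<Sum>l<N. if l = j then of_int c * a ^ i * b ^ j else 0) else 0)"
      by (cases "k = i") simp_all
  qed
  also have "\<dots> = of_int c * a ^ i * b ^ j"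
    by (simp add: N_def)
  finally have "of_int c * a ^ i * b ^ j =
      (\<Sum>k<N. \<Sum>l<N. of_int (if k = i \<and> l = j then c else 0) * a ^ k * b ^ l)"
    by (rule sym)
  then show ?thesis
    unfolding int_poly2_ring_def mem_Collect_eq
    by - (rule exI[of _ N], rule exI[of _ "\<lambda>k l. if k = i \<and> l = j then c else 0"])
qed

text \<open>Each element brings its own square index range. Padding with zeros gives two elements a
  common range, so that they can be added coefficientwise.\<close>

lemma int_poly2_ring_extend:
  assumes "N \<le> M"
  shows "(\<Sum>i<N. \<Sum>j<N. of_int (c i j) * a ^ i * b ^ j) =
    (\<Sum>i<M. \<Sum>j<M. of_int (if i < N \<and> j < N then c i j else 0) * a ^ i * b ^ j :: complex)"
  using assms
  by (intro sum.mono_neutral_cong_left) (auto intro!: sum.mono_neutral_cong_left sum.neutral)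

lemma int_poly2_ring_add:
  assumes "x \<in> int_poly2_ring a b" "y \<in> int_poly2_ring a b"
  shows "x + y \<in> int_poly2_ring a b"
proof -
  obtain N c where x: "x = (\<Sum>i<N. \<Sum>j<N. of_int (c i j) * a ^ i * b ^ j)"
    using assms unfolding int_poly2_ring_def by blast
  obtain M d where y: "y = (\<Sum>i<M. \<Sum>j<M. of_int (d i j) * a ^ i * b ^ j)"
    using assms unfolding int_poly2_ring_def by blast
  let ?K = "max N M"
  let ?e = "\<lambda>i j. (if i < N \<and> j < N then c i j else 0) + (if i < M \<and> j < M then d i j else 0)"
  have "x + y = (\<Sum>i<?K. \<Sum>j<?K. of_int (?e i j) * a ^ i * b ^ j)"
    unfolding x y int_poly2_ring_extend[OF max.cobounded1[of N M]]
      int_poly2_ring_extend[OF max.cobounded2[of M N]]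
    by (simp add: sum.distrib[symmetric] algebra_simps)
  then show ?thesis
    unfolding int_poly2_ring_def mem_Collect_eq by - (rule exI[of _ ?K], rule exI[of _ ?e])
qed

lemma int_poly2_ring_of_int: "of_int c \<in> int_poly2_ring a b"
  using int_poly2_ring_monomial[of c a 0 b 0] by simp

lemma int_poly2_ring_of_nat: "of_nat c \<in> int_poly2_ring a b"
  using int_poly2_ring_of_int[of "int c"] by simp

lemma int_poly2_ring_0: "0 \<in> int_poly2_ring a b"
  using int_poly2_ring_of_int[of 0] by simp

lemma int_poly2_ring_1: "1 \<in> int_poly2_ring a b"
  using int_poly2_ring_of_int[of 1] by simp

lemma int_poly2_ring_gens: "a \<in> int_poly2_ring a b" "b \<in> int_poly2_ring a b"
  using int_poly2_ring_monomial[of 1 a 1 b 0] int_poly2_ring_monomial[of 1 a 0 b 1] by simp_all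

lemma int_poly2_ring_sum:
  "(\<And>i. i \<in> A \<Longrightarrow> f i \<in> int_poly2_ring a b) \<Longrightarrow> sum f A \<in> int_poly2_ring a b"
  by (induction A rule: infinite_finite_induct) (auto intro: int_poly2_ring_0 int_poly2_ring_add)

lemma int_poly2_ring_mult:
  assumes "x \<in> int_poly2_ring a b" "y \<in> int_poly2_ring a b"
  shows "x * y \<in> int_poly2_ring a b"
proof -
  obtain N c where x: "x = (\<Sum>i<N. \<Sum>j<N. of_int (c i j) * a ^ i * b ^ j)"
    using assms unfolding int_poly2_ring_def by blast
  obtain M d where y: "y = (\<Sum>i<M. \<Sum>j<M. of_int (d i j) * a ^ i * b ^ j)"
    using assms unfolding int_poly2_ring_def by blast
  have "of_int (c i j) * a ^ i * b ^ j * (of_int (d k l) * a ^ k * b ^ l) \<in> int_poly2_ring a b" for i j k l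
    using int_poly2_ring_monomial[of "c i j * d k l" a "i + k" b "j + l"]
    by (simp add: power_add mult_ac)
  then show ?thesis
    unfolding x y sum_distrib_right sum_distrib_left
    by (intro int_poly2_ring_sum) blast
qed

lemma int_poly2_ring_minus:
  "x \<in> int_poly2_ring a b \<Longrightarrow> - x \<in> int_poly2_ring a b"
  using int_poly2_ring_mult[OF int_poly2_ring_of_int[of "-1"], of x a b] by simp

lemma int_poly2_ring_diff:
  assumes "x \<in> int_poly2_ring a b" "y \<in> int_poly2_ring a b"
  shows "x - y \<in> int_poly2_ring a b"
  using int_poly2_ring_add[OF assms(1) int_poly2_ring_minus[OF assms(2)]] by simp

lemma int_poly2_ring_power:
  "x \<in> int_poly2_ring a b \<Longrightarrow> x ^ n \<in> int_poly2_ring a b"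
  by (induction n) (auto intro: int_poly2_ring_1 int_poly2_ring_mult)

lemma int_poly2_ring_numeral: "numeral n \<in> int_poly2_ring a b"
  using int_poly2_ring_of_nat[of "numeral n"] by simp

text \<open>Here \<open>d\<close> is a formal degree: \<open>c\<close> may be 0. Differences can
  thus be handled without deciding whether their top terms cancel.\<close>

definition top_coeff :: "complex \<Rightarrow> complex \<Rightarrow> complex poly \<Rightarrow> nat \<Rightarrow> complex \<Rightarrow> bool" where
  "top_coeff a b p d c \<longleftrightarrow>
     degree p \<le> d \<and> coeff p d = c \<and> (\<forall>i. coeff p i \<in> int_poly2_ring a b)"

lemma top_coeff_mult:
  assumes "top_coeff a b p d c" "top_coeff a b q e k"
  shows "top_coeff a b (p * q) (d + e) (c * k)"
proof -
  have deg: "degree p \<le> d" "degree q \<le> e" using assms by (auto simp: top_coeff_def)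
  have "coeff (p * q) (d + e) = (\<Sum>i\<le>d+e. if i = d then c * k else 0)"
    unfolding coeff_mult
  proof (intro sum.cong refl)
    fix i assume "i \<in> {..d+e}"
    consider "i < d" | "i = d" | "i > d" by linarith
    then show "coeff p i * coeff q (d + e - i) = (if i = d then c * k else 0)"
    proof cases
      case 1
      then have "coeff q (d + e - i) = 0" using deg by (intro coeff_eq_0) linarith
      then show ?thesis using 1 by simp
    next
      case 2
      then show ?thesis using assms by (simp add: top_coeff_def)
    next
      case 3
      then have "coeff p i = 0" using deg by (intro coeff_eq_0) linarith
      then show ?thesis using 3 by simp
    qed
  qed
  also have "\<dots> = c * k" by simp
  finally have "coeff (p * q) (d + e) = c * k" .
  moreover have "degree (p * q) \<le> d + e"
    using degree_mult_le[of p q] deg by linarith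
  moreover have "coeff (p * q) i \<in> int_poly2_ring a b" for i
    unfolding coeff_mult using assms
    by (auto simp: top_coeff_def intro!: int_poly2_ring_sum int_poly2_ring_mult)
  ultimately show ?thesis by (simp add: top_coeff_def)
qed

lemma top_coeff_diff:
  assumes "top_coeff a b p d c" "top_coeff a b q d k"
  shows "top_coeff a b (p - q) d (c - k)"
  using assms degree_diff_le[of p d q] by (auto simp: top_coeff_def intro: int_poly2_ring_diff)

lemma top_coeff_1: "top_coeff a b 1 0 1"
  using int_poly2_ring_0 int_poly2_ring_1 by (auto simp: top_coeff_def coeff_1)

lemma top_coeff_power:
  "top_coeff a b p d c \<Longrightarrow> top_coeff a b (p ^ n) (n * d) (c ^ n)"
proof (induction n)
  case (Suc n)
  from top_coeff_mult[OF Suc.prems Suc.IH[OF Suc.prems]] show ?case by simp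
qed (simp add: top_coeff_1)

text \<open>Multiplying \<open>c x^d + ... = 0\<close> by \<open>k^d / c\<close> gives a monic
  equation for \<open>k x\<close> with coefficients \<open>coeff p i * k^(d-i) / c\<close>. For
  \<open>i < d\<close> the factor \<open>k^(d-i) / c\<close> is an integer because \<open>c\<close>
  divides \<open>k\<close>.\<close>

lemma integral_over_of_root:
  assumes p: "top_coeff a b p d (of_nat c)" and root: "poly p x = 0"
    and c: "c > 0" "c dvd k" "k > 0"
  shows "integral_over (int_poly2_ring a b) (of_nat k * x)"
proof -
  \<comment> \<open>Index \<open>d\<close> needs its own clause: there \<open>coeff p d = c\<close>
    cancels the denominator, whereas \<open>k ^ 0 div c\<close> is 0 for
    \<open>c > 1\<close>.\<close>
  define q where "q i = (if i = d then 1 else coeff p i * of_nat (k ^ (d - i) div c))" for i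
  define Q where "Q = (\<Sum>i\<le>d. monom (q i) i)"
  have coeff_Q: "coeff Q i = (if i \<le> d then q i else 0)" for i
    by (simp add: Q_def coeff_sum)
  have "degree Q \<le> d"
    by (rule degree_le) (simp add: coeff_Q)
  moreover have "d \<le> degree Q"
    by (rule le_degree) (simp add: coeff_Q q_def)
  ultimately have "degree Q = d" by simp
  then have lead: "lead_coeff Q = 1" by (simp add: coeff_Q q_def)
  have coeffs: "coeff Q i \<in> int_poly2_ring a b" for i
    using p unfolding coeff_Q q_def top_coeff_def
    by (auto simp del: of_nat_power intro: int_poly2_ring_0 int_poly2_ring_1
        int_poly2_ring_mult int_poly2_ring_of_nat)
  have cq: "of_nat c * q i = coeff p i * of_nat k ^ (d - i)" if "i \<le> d" for i
  proof (cases "i = d")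
    case True
    then show ?thesis using p by (simp add: q_def top_coeff_def)
  next
    case False
    then have "c dvd k ^ (d - i)"
      using c that by (intro dvd_trans[OF \<open>c dvd k\<close> dvd_power]) auto
    then have "of_nat c * of_nat (k ^ (d - i) div c) = (of_nat k ^ (d - i) :: complex)"
      by (metis dvd_mult_div_cancel of_nat_mult of_nat_power)
    then show ?thesis using False by (simp add: q_def mult_ac)
  qed
  have "of_nat c * poly Q (of_nat k * x) = (\<Sum>i\<le>d. (of_nat c * q i) * (of_nat k * x) ^ i)"
    by (simp add: Q_def poly_sum poly_monom sum_distrib_left mult_ac)
  also have "\<dots> = (\<Sum>i\<le>d. of_nat k ^ d * (coeff p i * x ^ i))"
  proof (intro sum.cong refl)
    fix i assume i: "i \<in> {..d}"
    then have "(of_nat k :: complex) ^ d = of_nat k ^ (d - i) * of_nat k ^ i"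
      by (simp flip: power_add)
    then show "(of_nat c * q i) * (of_nat k * x) ^ i = of_nat k ^ d * (coeff p i * x ^ i)"
      using i cq[of i] by (simp add: power_mult_distrib mult_ac)
  qed
  also have "\<dots> = of_nat k ^ d * poly p x"
  proof -
    have "p = (\<Sum>i\<le>d. monom (coeff p i) i)"
      using p poly_as_sum_of_monoms'[of p d] by (simp add: top_coeff_def)
    then have "poly p x = (\<Sum>i\<le>d. coeff p i * x ^ i)"
      by (subst (asm) poly_eq_poly_eq_iff[symmetric]) (simp add: fun_eq_iff poly_sum poly_monom)
    then show ?thesis by (simp add: sum_distrib_left)
  qed
  finally have "poly Q (of_nat k * x) = 0"
    using root c by simp
  then show ?thesis
    using lead coeffs unfolding integral_over_def by blast
qed

section \<open>Elliptic divisibility from the addition formulas\<close>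

text \<open>\<open>biquad h2 h3 (\<wp> c) (\<wp> a) (\<wp> b)\<close> will be the product
  \<open>(\<wp> (a + b) - \<wp> c) (\<wp> (a - b) - \<wp> c) (\<wp> a - \<wp> b)\<^sup>2\<close>.\<close>

definition biquad :: "complex \<Rightarrow> complex \<Rightarrow> complex \<Rightarrow> complex \<Rightarrow> complex \<Rightarrow> complex" where
  "biquad h2 h3 t r s = t\<^sup>2 * (r - s)\<^sup>2 - 2 * t * (r * s - h2) * (r + s) + 4 * h3 * t
     + (r * s + h2)\<^sup>2 + 4 * h3 * (r + s)"

text \<open>The definition is visibly symmetric in \<open>r\<close> and \<open>s\<close>. With the
  rotation, one value of \<open>biquad\<close> can be read as a product formula for any of the three
  pairs.\<close>

lemma biquad_rotate: "biquad h2 h3 t r s = biquad h2 h3 s t r"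
  by (simp add: biquad_def power2_eq_square algebra_simps)

text \<open>Prepares \<open>W_4\<close>: for \<open>X = x 1\<close>, \<open>r = x 2\<close>,
  \<open>D = w^2\<close> the left side is \<open>(X - x 3) (X - x 2)^2 w^4\<close>. In the addition
  formula for the pair (2, 1), \<open>t = X\<close> would make the factor \<open>x 1 - t\<close>
  vanish, while \<open>t = X + 1\<close> makes it -1.\<close>

lemma biquad_triple:
  assumes r: "r * D = biquad h2 h3 0 X X" and D: "D = 4 * (X ^ 3 - h2 * X - h3)"
  shows "(biquad h2 h3 (X + 1) r X - (r - X)\<^sup>2) * D\<^sup>2 =
    D * (2 * (X ^ 6 - 5 * h2 * X ^ 4 - 20 * h3 * X ^ 3 - 5 * h2\<^sup>2 * X\<^sup>2
    - 4 * h2 * h3 * X - 8 * h3\<^sup>2 + h2 ^ 3))"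
proof -
  define M where "M = r * D"
  have M: "M = X ^ 4 + 2 * h2 * X\<^sup>2 + h2\<^sup>2 + 8 * h3 * X"
    unfolding M_def r biquad_def by (simp add: algebra_simps eval_nat_numeral)
  \<comment> \<open>As a quadratic in \<open>t\<close>, \<open>biquad\<close> grows from
    \<open>X\<close> to \<open>X + 1\<close> by \<open>2 X + 1\<close> times its leading coefficient
    \<open>(r - X)^2\<close> plus its linear coefficient. Multiplying by \<open>D^2\<close> replaces
    \<open>r\<close> by the polynomial \<open>M\<close>.\<close>
  have "(biquad h2 h3 (X + 1) r X - (r - X)\<^sup>2) * D\<^sup>2 =
      (2 * X) * (M - X * D)\<^sup>2 - 2 * (M * X - h2 * D) * (M + X * D) + 4 * h3 * D\<^sup>2
      + D\<^sup>2 * biquad h2 h3 X r X"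
    unfolding M_def biquad_def by (simp add: algebra_simps power2_eq_square)
  \<comment> \<open>After rotation this is the duplication formula at \<open>t = r\<close>, whose
    other side contains \<open>r - r\<close>.\<close>
  also have "D\<^sup>2 * biquad h2 h3 X r X = D\<^sup>2 * biquad h2 h3 r X X"
    by (metis biquad_rotate)
  also have "\<dots> = 0" unfolding biquad_def using r unfolding D biquad_def
    by (simp add: algebra_simps eval_nat_numeral)
  finally show ?thesis
    unfolding M D by (simp add: algebra_simps eval_nat_numeral)
qed

fun div_seq :: "complex \<Rightarrow> (nat \<Rightarrow> complex) \<Rightarrow> nat \<Rightarrow> complex" where
  "div_seq w x 0 = 0"
| "div_seq w x (Suc 0) = 1"
| "div_seq w x (Suc (Suc 0)) = w"
| "div_seq w x (Suc (Suc (Suc n))) =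
     (x 1 - x (Suc (Suc n))) * (div_seq w x (Suc (Suc n)))\<^sup>2 / div_seq w x (Suc n)"

text \<open>Models \<open>x n = \<wp> (n u)\<close> and \<open>w = \<wp>' u\<close> for \<open>u\<close> of exact order \<open>N\<close> modulo the lattice;
  \<open>div_seq\<close> is meaningful only up to index \<open>N\<close>, beyond which it divides by zero.\<close>

locale torsion_abscissae =
  fixes N :: nat and x :: "nat \<Rightarrow> complex" and w h2 h3 :: complex
  assumes N: "N \<ge> 3"
    and w_nz: "w \<noteq> 0"
    and inj: "\<And>p q. 1 \<le> q \<Longrightarrow> q < p \<Longrightarrow> p + q < N \<Longrightarrow> x p \<noteq> x q"
    and last: "x (N - 1) = x 1"
    and curve: "w\<^sup>2 = 4 * (x 1 ^ 3 - h2 * x 1 - h3)"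
    and dbl: "\<And>t. (x 2 - t) * w\<^sup>2 = biquad h2 h3 t (x 1) (x 1)"
    and add: "\<And>p q t. 1 \<le> q \<Longrightarrow> q < p \<Longrightarrow> p + q < N \<Longrightarrow>
      (x (p + q) - t) * (x (p - q) - t) * (x p - x q)\<^sup>2 = biquad h2 h3 t (x p) (x q)"
begin

abbreviation "W \<equiv> div_seq w x"

lemma W_2: "W 2 = w"
  by (simp add: numeral_2_eq_2)

text \<open>The factor introduced at index \<open>n\<close> is \<open>x 1 - x (n - 1)\<close>, and
  \<open>n < N\<close> is exactly the range condition of \<open>inj\<close> for the pair
  \<open>(n - 1, 1)\<close>.\<close>

lemma W_nz: "1 \<le> n \<Longrightarrow> n < N \<Longrightarrow> W n \<noteq> 0"
proof (induction n rule: less_induct)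
  case (less n)
  consider "n = 1" | "n = 2" | k where "n = Suc (Suc (Suc k))"
    using less.prems by (cases n; cases "n - 1"; cases "n - 2") auto
  then show ?case
  proof cases
    case 3
    have "x (Suc (Suc k)) \<noteq> x 1"
      using less.prems 3 by (intro inj) auto
    then show ?thesis
      using less.IH[of "Suc k"] less.IH[of "Suc (Suc k)"] less.prems 3 by auto
  qed (auto simp: w_nz numeral_2_eq_2)
qed

lemma W_last: "W N = 0"
proof -
  obtain k where k: "N = Suc (Suc (Suc k))"
    using N by (cases N; cases "N - 1"; cases "N - 2") auto
  then have "x 1 = x (Suc (Suc k))" using last by simp
  then show ?thesis by (simp only: k div_seq.simps) simp
qed

lemma W_rec:
  assumes "1 \<le> p" "p < N"
  shows "W (p + 1) * W (p - 1) = (x 1 - x p) * (W p)\<^sup>2"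
proof (cases "p = 1")
  case False
  then obtain k where k: "p = Suc (Suc k)"
    using assms False by (cases p; cases "p - 1") auto
  then show ?thesis using W_nz[of "Suc k"] assms by simp
qed auto

text \<open>Second base case for \<open>W_eds\<close>. The induction step there uses the addition
  formula for \<open>(k, 1)\<close>, which requires \<open>k > 1\<close>; for the step from 1 to 2
  the duplication formula takes its place.\<close>

lemma W_rec2:
  assumes "2 \<le> p" "p + 2 \<le> N"
  shows "W (p + 2) * W (p - 2) = (x 2 - x p) * (W p)\<^sup>2 * w\<^sup>2"
proof (cases "p = 2")
  case True
  then show ?thesis by simp
next
  case False
  have r1: "W (p + 2) * W p = (x 1 - x (p + 1)) * (W (p + 1))\<^sup>2"
    using W_rec[of "p + 1"] assms by simp
  have r2: "W p * W (p - 2) = (x 1 - x (p - 1)) * (W (p - 1))\<^sup>2"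
    using W_rec[of "p - 1"] assms by (simp add: numeral_2_eq_2)
  have r3: "W (p + 1) * W (p - 1) = (x 1 - x p) * (W p)\<^sup>2"
    using W_rec[of p] assms by simp
  \<comment> \<open>The duplication formula at \<open>t = x p\<close> and the addition formula for
    \<open>(p, 1)\<close> at \<open>t = x 1\<close> are the same value of
    \<open>biquad\<close>.\<close>
  have "(x 2 - x p) * w\<^sup>2 = biquad h2 h3 (x 1) (x p) (x 1)"
    using dbl[of "x p"] biquad_rotate[of h2 h3 "x p" "x 1" "x 1"] by simp
  also have "\<dots> = (x (p + 1) - x 1) * (x (p - 1) - x 1) * (x p - x 1)\<^sup>2"
    using add[of 1 p "x 1"] assms by simp
  finally have key: "(x 1 - x (p + 1)) * (x 1 - x (p - 1)) * (x 1 - x p)\<^sup>2 = (x 2 - x p) * w\<^sup>2"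
    by (simp add: power2_eq_square algebra_simps)
  have nz: "W p \<noteq> 0" using W_nz[of p] assms by simp
  have "W (p + 2) * W (p - 2) * (W p)\<^sup>2 = (W (p + 2) * W p) * (W p * W (p - 2))"
    by (simp add: power2_eq_square)
  also have "\<dots> = (x 1 - x (p + 1)) * (x 1 - x (p - 1)) * (W (p + 1) * W (p - 1))\<^sup>2"
    unfolding r1 r2 by (simp add: power2_eq_square)
  also have "\<dots> = ((x 1 - x (p + 1)) * (x 1 - x (p - 1)) * (x 1 - x p)\<^sup>2) * (W p) ^ 4"
    unfolding r3 by (simp add: power2_eq_square power4_eq_xxxx)
  also have "\<dots> = (x 2 - x p) * (W p)\<^sup>2 * w\<^sup>2 * (W p)\<^sup>2"
    unfolding key by (simp add: power2_eq_square power4_eq_xxxx)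
  finally show ?thesis using nz by simp
qed

lemma W_eds:
  "1 \<le> q \<Longrightarrow> q \<le> p \<Longrightarrow> p + q \<le> N \<Longrightarrow>
    W (p + q) * W (p - q) = (x q - x p) * (W p)\<^sup>2 * (W q)\<^sup>2"
proof (induction q arbitrary: p rule: less_induct)
  case (less q)
  consider "q = 1" | "q = 2" | "q = p" | "3 \<le> q" "q + 1 \<le> p"
    using less.prems by linarith
  then show ?case
  proof cases
    case 1
    then show ?thesis using W_rec[of p] less.prems by simp
  next
    case 2
    then show ?thesis using W_rec2[of p] less.prems by (simp add: numeral_2_eq_2)
  next
    case 3
    then show ?thesis by simp
  next
    case q: 4
    define k where "k = q - 1"
    have 4: "q = k + 1" "2 \<le> k" "k + 2 \<le> p" using q by (auto simp: k_def)
    note p = less.prems[unfolded 4]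
    \<comment> \<open>Multiplying the goal for \<open>q = k + 1\<close> by the product
      \<open>A\<close> belonging to \<open>q = k - 1\<close> pairs the four factors into two
      instances of \<open>W_rec\<close>, centred at \<open>p + k\<close> and \<open>p - k\<close>.
      The indices in \<open>A\<close> lie strictly between 0 and \<open>N\<close>, so
      \<open>A\<close> can be cancelled at the end.\<close>
    define A where "A = W (p + (k - 1)) * W (p - (k - 1))"
    have r1: "W (p + (k + 1)) * W (p + (k - 1)) = (x 1 - x (p + k)) * (W (p + k))\<^sup>2"
      using W_rec[of "p + k"] p 4 by simp
    have r2: "W (p - (k - 1)) * W (p - (k + 1)) = (x 1 - x (p - k)) * (W (p - k))\<^sup>2"
      using W_rec[of "p - k"] p 4 by (simp add: Suc_diff_le)
    have r3: "W (k + 1) * W (k - 1) = (x 1 - x k) * (W k)\<^sup>2"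
      using W_rec[of k] p 4 by simp
    have i1: "W (p + k) * W (p - k) = (x k - x p) * (W p)\<^sup>2 * (W k)\<^sup>2"
      using less.IH[of k p] p 4 by simp
    have i2: "A = (x (k - 1) - x p) * (W p)\<^sup>2 * (W (k - 1))\<^sup>2"
      unfolding A_def using less.IH[of "k - 1" p] p 4 by simp
    have nz: "A \<noteq> 0"
      unfolding A_def using p 4 by (simp add: W_nz)
    \<comment> \<open>One value of \<open>biquad\<close> is read twice: for the pair
      \<open>(k, 1)\<close> at \<open>t = x p\<close> and for the pair \<open>(p, k)\<close> at
      \<open>t = x 1\<close>.\<close>
    have "(x (k + 1) - x p) * (x (k - 1) - x p) * (x k - x 1)\<^sup>2 = biquad h2 h3 (x p) (x k) (x 1)"
      using add[of 1 k "x p"] p 4 by simp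
    also have "\<dots> = biquad h2 h3 (x 1) (x p) (x k)" by (rule biquad_rotate)
    also have "\<dots> = (x (p + k) - x 1) * (x (p - k) - x 1) * (x p - x k)\<^sup>2"
      using add[of k p "x 1"] p 4 by simp
    finally have key: "(x 1 - x (p + k)) * (x 1 - x (p - k)) * (x k - x p)\<^sup>2 =
        (x (k + 1) - x p) * (x (k - 1) - x p) * (x 1 - x k)\<^sup>2"
      by (simp add: power2_eq_square algebra_simps)
    have "W (p + (k + 1)) * W (p - (k + 1)) * A =
        (W (p + (k + 1)) * W (p + (k - 1))) * (W (p - (k - 1)) * W (p - (k + 1)))"
      by (simp add: A_def)
    also have "\<dots> = (x 1 - x (p + k)) * (x 1 - x (p - k)) * (W (p + k) * W (p - k))\<^sup>2"
      unfolding r1 r2 by (simp add: power2_eq_square)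
    also have "\<dots> = ((x 1 - x (p + k)) * (x 1 - x (p - k)) * (x k - x p)\<^sup>2) * (W p) ^ 4 * (W k) ^ 4"
      unfolding i1 by (simp add: power2_eq_square power4_eq_xxxx)
    also have "\<dots> = (x (k + 1) - x p) * (x (k - 1) - x p) * ((x 1 - x k) * (W k)\<^sup>2)\<^sup>2 * (W p) ^ 4"
      unfolding key by (simp add: power2_eq_square power4_eq_xxxx)
    also have "\<dots> = (x (k + 1) - x p) * (W p)\<^sup>2 * (W (k + 1))\<^sup>2 * A"
      unfolding r3[symmetric] i2 by (simp add: power2_eq_square power4_eq_xxxx)
    finally show ?thesis using nz 4 by simp
  qed
qed

text \<open>In \<open>W_eds\<close> the pair \<open>(n + 1, n)\<close> has second factor
  \<open>W 1 = 1\<close>. Inserting \<open>x 1\<close> between \<open>x n\<close> and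
  \<open>x (n + 1)\<close> turns the difference into two products given by
  \<open>W_rec\<close>.\<close>

lemma W_odd:
  assumes "2 \<le> n" "2 * n + 1 \<le> N"
  shows "W (2 * n + 1) = W (n + 2) * W n ^ 3 - W (n - 1) * W (n + 1) ^ 3"
proof -
  have r1: "W (n + 2) * W n = (x 1 - x (n + 1)) * (W (n + 1))\<^sup>2"
    using W_rec[of "n + 1"] assms by simp
  have r2: "W (n + 1) * W (n - 1) = (x 1 - x n) * (W n)\<^sup>2"
    using W_rec[of n] assms by simp
  have "W (2 * n + 1) = (x n - x (n + 1)) * (W (n + 1))\<^sup>2 * (W n)\<^sup>2"
    using W_eds[of n "n + 1"] assms by (simp add: mult_2)
  also have "\<dots> = ((x 1 - x (n + 1)) * (W (n + 1))\<^sup>2) * (W n)\<^sup>2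
      - ((x 1 - x n) * (W n)\<^sup>2) * (W (n + 1))\<^sup>2"
    by (simp add: algebra_simps)
  also have "\<dots> = W (n + 2) * W n ^ 3 - W (n - 1) * W (n + 1) ^ 3"
    unfolding r1[symmetric] r2[symmetric] by (simp add: power2_eq_square power3_eq_cube)
  finally show ?thesis .
qed

text \<open>As for \<open>W_odd\<close>, with the pair \<open>(n + 1, n - 1)\<close>; the second
  factor is now \<open>W 2 = w\<close>.\<close>

lemma W_even:
  assumes "3 \<le> n" "2 * n \<le> N"
  shows "W (2 * n) * w = W n * (W (n + 2) * (W (n - 1))\<^sup>2 - W (n - 2) * (W (n + 1))\<^sup>2)"
proof -
  have r1: "W (n + 2) * W n = (x 1 - x (n + 1)) * (W (n + 1))\<^sup>2"
    using W_rec[of "n + 1"] assms by simp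
  have r2: "W n * W (n - 2) = (x 1 - x (n - 1)) * (W (n - 1))\<^sup>2"
    using W_rec[of "n - 1"] assms by (simp add: numeral_2_eq_2)
  have "n + 1 + (n - 1) = 2 * n" "n + 1 - (n - 1) = 2" using assms by simp_all
  then have "W (2 * n) * w = (x (n - 1) - x (n + 1)) * (W (n + 1))\<^sup>2 * (W (n - 1))\<^sup>2"
    using W_eds[of "n - 1" "n + 1"] assms by (simp only: W_2)
  also have "\<dots> = ((x 1 - x (n + 1)) * (W (n + 1))\<^sup>2) * (W (n - 1))\<^sup>2
      - ((x 1 - x (n - 1)) * (W (n - 1))\<^sup>2) * (W (n + 1))\<^sup>2"
    by (simp add: algebra_simps)
  also have "\<dots> = W n * (W (n + 2) * (W (n - 1))\<^sup>2 - W (n - 2) * (W (n + 1))\<^sup>2)"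
    unfolding r1[symmetric] r2[symmetric] by (simp add: algebra_simps)
  finally show ?thesis .
qed


text \<open>\<open>W_odd\<close> at \<open>n = 1\<close> and \<open>W_even\<close> at
  \<open>n = 2\<close> would be tautologies, so \<open>W 3\<close> and \<open>W 4\<close> are
  computed by hand. Here the duplication formula at \<open>t = x 1\<close> suffices.\<close>

lemma W_3: "W 3 = 3 * x 1 ^ 4 - 6 * h2 * (x 1)\<^sup>2 - 12 * h3 * x 1 - h2\<^sup>2"
proof -
  have "W 3 = (x 1 - x 2) * w\<^sup>2"
    using W_rec[of 2] N by (simp add: W_2)
  also have "\<dots> = - biquad h2 h3 (x 1) (x 1) (x 1)"
    unfolding dbl[of "x 1", symmetric] by (simp add: algebra_simps)
  also have "\<dots> = 3 * x 1 ^ 4 - 6 * h2 * (x 1)\<^sup>2 - 12 * h3 * x 1 - h2\<^sup>2"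
    unfolding biquad_def by (simp add: algebra_simps eval_nat_numeral)
  finally show ?thesis .
qed

lemma W_4:
  assumes "N \<ge> 4"
  shows "W 4 = w * (2 * (x 1 ^ 6 - 5 * h2 * x 1 ^ 4 - 20 * h3 * x 1 ^ 3 - 5 * h2\<^sup>2 * (x 1)\<^sup>2
    - 4 * h2 * h3 * x 1 - 8 * h3\<^sup>2 + h2 ^ 3))" (is "_ = w * ?P")
proof -
  define X where "X = x 1"
  have d: "x 2 * w\<^sup>2 = biquad h2 h3 0 X X" using dbl[of 0] by (simp add: X_def)
  have c: "w\<^sup>2 = 4 * (X ^ 3 - h2 * X - h3)" using curve by (simp add: X_def)
  have x3: "(X - x 3) * (X - x 2)\<^sup>2 = biquad h2 h3 (X + 1) (x 2) X - (x 2 - X)\<^sup>2"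
  proof -
    have "(x 3 - (X + 1)) * (x 1 - (X + 1)) * (x 2 - x 1)\<^sup>2 = biquad h2 h3 (X + 1) (x 2) (x 1)"
      using add[of 1 2 "X + 1"] assms by simp
    then show ?thesis unfolding X_def by (simp add: power2_eq_square algebra_simps)
  qed
  have "W 4 * w = (X - x 3) * ((X - x 2) * w\<^sup>2)\<^sup>2"
    using W_rec[of 3] W_rec[of 2] assms N by (simp add: W_2 X_def)
  also have "\<dots> = (biquad h2 h3 (X + 1) (x 2) X - (x 2 - X)\<^sup>2) * (w\<^sup>2)\<^sup>2"
    unfolding x3[symmetric] by (simp add: power2_eq_square)
  also have "\<dots> = w\<^sup>2 * ?P"
    unfolding X_def[symmetric] by (rule biquad_triple[OF d c])
  finally show ?thesis using w_nz by (simp add: power2_eq_square)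
qed

end

section \<open>Division polynomials\<close>

lemma top_coeff_cong:
  "top_coeff a b p d c \<Longrightarrow> d = d' \<Longrightarrow> c = c' \<Longrightarrow> top_coeff a b p d' c'"
  by simp

context torsion_abscissae
begin

lemma W_1: "W 1 = 1"
  by simp

declare div_seq.simps [simp del]

text \<open>The indices are \<open>n = 2 k + 1\<close> and \<open>n = 2 k + 2\<close>, so the degrees are the usual
  \<open>(n\<^sup>2 - 1) / 2\<close> and \<open>(n\<^sup>2 - 4) / 2\<close>.\<close>

definition odd_poly :: "nat \<Rightarrow> complex poly \<Rightarrow> bool" where
  "odd_poly k p \<longleftrightarrow>
     top_coeff h2 h3 p (2 * k * (k + 1)) (of_nat (2 * k + 1)) \<and> W (2 * k + 1) = poly p (x 1)"

definition even_poly :: "nat \<Rightarrow> complex poly \<Rightarrow> bool" where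
  "even_poly k p \<longleftrightarrow>
     top_coeff h2 h3 p (2 * k * (k + 2)) (of_nat (k + 1)) \<and> W (2 * k + 2) = w * poly p (x 1)"

text \<open>Each even-index term carries one factor \<open>w\<close>. In the odd recursion these
  occur only as \<open>w^4\<close>, which the curve equation makes a polynomial in
  \<open>x 1\<close>.\<close>

definition w2_poly :: "complex poly" where
  "w2_poly = [: - 4 * h3, - 4 * h2, 0, 4 :]"

lemma w2_poly: "top_coeff h2 h3 w2_poly 3 4" "w\<^sup>2 = poly w2_poly (x 1)"
proof -
  have "coeff w2_poly i \<in> int_poly2_ring h2 h3" for i
    unfolding w2_poly_def
    by (auto simp: coeff_pCons split: nat.split intro!: int_poly2_ring_mult int_poly2_ring_minus
        int_poly2_ring_gens int_poly2_ring_numeral int_poly2_ring_0)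
  moreover have "degree w2_poly \<le> 3" "coeff w2_poly 3 = 4"
    unfolding w2_poly_def by (simp_all add: numeral_3_eq_3)
  ultimately show "top_coeff h2 h3 w2_poly 3 4" by (simp add: top_coeff_def)
  show "w\<^sup>2 = poly w2_poly (x 1)"
    unfolding curve w2_poly_def by (simp add: algebra_simps power3_eq_cube)
qed

lemma odd_poly_0: "odd_poly 0 1"
  using W_1 by (simp add: odd_poly_def top_coeff_1)

lemma even_poly_0: "even_poly 0 1"
  using W_2 by (simp add: even_poly_def top_coeff_1 numeral_2_eq_2)

lemma odd_poly_1: "odd_poly 1 [: - h2\<^sup>2, - 12 * h3, - 6 * h2, 0, 3 :]" (is "odd_poly 1 ?p")
proof -
  have "coeff ?p i \<in> int_poly2_ring h2 h3" for i
    by (auto simp: coeff_pCons split: nat.split intro!: int_poly2_ring_mult int_poly2_ring_minus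
        int_poly2_ring_power int_poly2_ring_gens int_poly2_ring_numeral int_poly2_ring_0)
  then have "top_coeff h2 h3 ?p 4 3"
    by (simp add: top_coeff_def eval_nat_numeral)
  moreover have "W 3 = poly ?p (x 1)"
    unfolding W_3 by (simp add: algebra_simps eval_nat_numeral)
  ultimately show ?thesis by (simp add: odd_poly_def)
qed

lemma even_poly_1:
  assumes "N \<ge> 4"
  shows "even_poly 1 [: 2 * (h2 ^ 3 - 8 * h3\<^sup>2), - 8 * h2 * h3, - 10 * h2\<^sup>2, - 40 * h3, - 10 * h2, 0, 2 :]"
    (is "even_poly 1 ?p")
proof -
  have "coeff ?p i \<in> int_poly2_ring h2 h3" for i
    by (auto simp: coeff_pCons split: nat.split intro!: int_poly2_ring_mult int_poly2_ring_minus
        int_poly2_ring_diff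
        int_poly2_ring_power int_poly2_ring_gens int_poly2_ring_numeral int_poly2_ring_0)
  then have "top_coeff h2 h3 ?p 6 2"
    by (simp add: top_coeff_def eval_nat_numeral)
  moreover have "W 4 = w * poly ?p (x 1)"
    unfolding W_4[OF assms] by (simp add: algebra_simps eval_nat_numeral)
  ultimately show ?thesis by (simp add: even_poly_def)
qed

text \<open>\<open>W_odd\<close> at \<open>n = 2 j + 2\<close>: both factors of the first product
  have even index, which produces \<open>w^4\<close>. The two products have the same formal degree,
  and the top coefficient follows from
  \<open>(n + 2) n^3 - (n - 1) (n + 1)^3 = 2 n + 1\<close>.\<close>

lemma odd_poly_step_even:
  assumes "odd_poly j p" "even_poly j q" "odd_poly (j + 1) r" "even_poly (j + 1) s" "4 * j + 5 \<le> N"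
  shows "odd_poly (2 * j + 2) (w2_poly ^ 2 * (s * q ^ 3) - p * r ^ 3)"
proof -
  have "top_coeff h2 h3 (w2_poly ^ 2 * (s * q ^ 3)) (2 * (2 * j + 2) * (2 * j + 2 + 1))
      (16 * of_nat (j + 2) * of_nat (j + 1) ^ 3)"
    using assms unfolding even_poly_def
    by (intro top_coeff_cong[OF top_coeff_mult[OF top_coeff_power[OF w2_poly(1), of 2]
            top_coeff_mult[OF _ top_coeff_power]]]) (auto simp: algebra_simps)
  moreover have "top_coeff h2 h3 (p * r ^ 3) (2 * (2 * j + 2) * (2 * j + 2 + 1))
      (of_nat (2 * j + 1) * of_nat (2 * j + 3) ^ 3)"
    using assms unfolding odd_poly_def
    by (intro top_coeff_cong[OF top_coeff_mult[OF _ top_coeff_power]]) (auto simp: algebra_simps)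
  ultimately have "top_coeff h2 h3 (w2_poly ^ 2 * (s * q ^ 3) - p * r ^ 3)
      (2 * (2 * j + 2) * (2 * j + 2 + 1)) (of_nat (2 * (2 * j + 2) + 1))"
    by (rule top_coeff_cong[OF top_coeff_diff]) (simp_all add: algebra_simps eval_nat_numeral)
  moreover have "W (2 * (2 * j + 2) + 1) = poly (w2_poly ^ 2 * (s * q ^ 3) - p * r ^ 3) (x 1)"
  proof -
    have "W (2 * (2 * j + 2) + 1) = W (2 * (j + 1) + 2) * W (2 * j + 2) ^ 3 - W (2 * j + 1) * W (2 * (j + 1) + 1) ^ 3"
      using W_odd[of "2 * j + 2"] assms(5) by (simp add: algebra_simps eval_nat_numeral)
    also have "\<dots> = (w\<^sup>2)\<^sup>2 * (poly s (x 1) * poly q (x 1) ^ 3) - poly p (x 1) * poly r (x 1) ^ 3"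
      using assms(1-4) unfolding odd_poly_def even_poly_def
      by (simp add: power_mult_distrib) (simp add: eval_nat_numeral)
    finally show ?thesis by (simp add: w2_poly(2))
  qed
  ultimately show ?thesis unfolding odd_poly_def by (rule conjI)
qed

text \<open>\<open>W_odd\<close> at \<open>n = 2 l + 3\<close>; now the second product carries
  \<open>w^4\<close>.\<close>

lemma odd_poly_step_odd:
  assumes "even_poly l p" "odd_poly (l + 1) q" "even_poly (l + 1) r" "odd_poly (l + 2) s" "4 * l + 7 \<le> N"
  shows "odd_poly (2 * l + 3) (s * q ^ 3 - w2_poly ^ 2 * (p * r ^ 3))"
proof -
  have "top_coeff h2 h3 (w2_poly ^ 2 * (p * r ^ 3)) (2 * (2 * l + 3) * (2 * l + 3 + 1))
      (16 * of_nat (l + 1) * of_nat (l + 2) ^ 3)"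
    using assms unfolding even_poly_def
    by (intro top_coeff_cong[OF top_coeff_mult[OF top_coeff_power[OF w2_poly(1), of 2]
            top_coeff_mult[OF _ top_coeff_power]]]) (auto simp: algebra_simps)
  moreover have "top_coeff h2 h3 (s * q ^ 3) (2 * (2 * l + 3) * (2 * l + 3 + 1))
      (of_nat (2 * l + 5) * of_nat (2 * l + 3) ^ 3)"
    using assms unfolding odd_poly_def
    by (intro top_coeff_cong[OF top_coeff_mult[OF _ top_coeff_power]]) (auto simp: algebra_simps)
  ultimately have "top_coeff h2 h3 (s * q ^ 3 - w2_poly ^ 2 * (p * r ^ 3))
      (2 * (2 * l + 3) * (2 * l + 3 + 1)) (of_nat (2 * (2 * l + 3) + 1))"
    by (intro top_coeff_cong[OF top_coeff_diff]) (auto simp: algebra_simps eval_nat_numeral)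
  moreover have "W (2 * (2 * l + 3) + 1) = poly (s * q ^ 3 - w2_poly ^ 2 * (p * r ^ 3)) (x 1)"
  proof -
    have "W (2 * (2 * l + 3) + 1) = W (2 * (l + 2) + 1) * W (2 * (l + 1) + 1) ^ 3 - W (2 * l + 2) * W (2 * (l + 1) + 2) ^ 3"
      using W_odd[of "2 * l + 3"] assms(5) by (simp add: algebra_simps eval_nat_numeral)
    also have "\<dots> = poly s (x 1) * poly q (x 1) ^ 3 - (w\<^sup>2)\<^sup>2 * (poly p (x 1) * poly r (x 1) ^ 3)"
      using assms(1-4) unfolding odd_poly_def even_poly_def
      by (simp add: power_mult_distrib) (simp add: eval_nat_numeral)
    finally show ?thesis by (simp add: w2_poly(2))
  qed
  ultimately show ?thesis unfolding odd_poly_def by (rule conjI)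
qed

text \<open>\<open>W_even\<close> at \<open>n = 2 l + 3\<close>. Both terms contain
  \<open>w^2\<close>, one \<open>w\<close> cancels against the left side, and the other is the
  factor kept in \<open>even_poly\<close>. The identity
  \<open>(n + 2) (n - 1)^2 - (n - 2) (n + 1)^2 = 4\<close> gives the top coefficient: the squared
  terms have even index and are each halved, leaving 1.\<close>

lemma even_poly_step_odd:
  assumes "odd_poly l p" "even_poly l q" "odd_poly (l + 1) r" "even_poly (l + 1) s" "odd_poly (l + 2) t"
    "4 * l + 6 \<le> N"
  shows "even_poly (2 * l + 2) (r * (t * q ^ 2 - p * s ^ 2))"
proof -
  have "top_coeff h2 h3 (t * q ^ 2) (2 * (l + 2) * (l + 3) + 4 * l * (l + 2))
      (of_nat (2 * l + 5) * of_nat (l + 1) ^ 2)"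
    using assms unfolding odd_poly_def even_poly_def
    by (intro top_coeff_cong[OF top_coeff_mult[OF _ top_coeff_power]]) (auto simp: algebra_simps)
  moreover have "top_coeff h2 h3 (p * s ^ 2) (2 * (l + 2) * (l + 3) + 4 * l * (l + 2))
      (of_nat (2 * l + 1) * of_nat (l + 2) ^ 2)"
    using assms unfolding odd_poly_def even_poly_def
    by (intro top_coeff_cong[OF top_coeff_mult[OF _ top_coeff_power]]) (auto simp: algebra_simps)
  ultimately have "top_coeff h2 h3 (t * q ^ 2 - p * s ^ 2)
      (2 * (l + 2) * (l + 3) + 4 * l * (l + 2)) 1"
    by (intro top_coeff_cong[OF top_coeff_diff]) (auto simp: algebra_simps eval_nat_numeral)
  then have "top_coeff h2 h3 (r * (t * q ^ 2 - p * s ^ 2)) (2 * (2 * l + 2) * (2 * l + 2 + 2)) (of_nat (2 * l + 2 + 1))"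
    using assms(3) unfolding odd_poly_def
    by (intro top_coeff_cong[OF top_coeff_mult]) (auto simp: algebra_simps)
  moreover have "W (2 * (2 * l + 2) + 2) = w * poly (r * (t * q ^ 2 - p * s ^ 2)) (x 1)"
  proof -
    have "W (2 * (2 * l + 2) + 2) * w = W (2 * (l + 1) + 1) *
        (W (2 * (l + 2) + 1) * (W (2 * l + 2))\<^sup>2 - W (2 * l + 1) * (W (2 * (l + 1) + 2))\<^sup>2)"
      using W_even[of "2 * l + 3"] assms(6) by (simp add: algebra_simps eval_nat_numeral)
    also have "\<dots> = (w * poly (r * (t * q ^ 2 - p * s ^ 2)) (x 1)) * w"
      using assms(1-5) unfolding odd_poly_def even_poly_def
      by (simp add: power_mult_distrib) (simp add: power2_eq_square algebra_simps)
    finally show ?thesis using w_nz by simp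
  qed
  ultimately show ?thesis unfolding even_poly_def by (rule conjI)
qed

text \<open>\<open>W_even\<close> at \<open>n = 2 l + 4\<close>. Here \<open>w^2\<close> comes from
  the outer factor and the unsquared inner one; only the latter halves the constant 4 of the same
  identity, leaving 2.\<close>

lemma even_poly_step_even:
  assumes "even_poly l p" "odd_poly (l + 1) q" "even_poly (l + 1) r" "odd_poly (l + 2) s" "even_poly (l + 2) t"
    "4 * l + 8 \<le> N"
  shows "even_poly (2 * l + 3) (r * (t * q ^ 2 - p * s ^ 2))"
proof -
  have "top_coeff h2 h3 (t * q ^ 2) (2 * (l + 2) * (l + 4) + 4 * (l + 1) * (l + 2))
      (of_nat (l + 3) * of_nat (2 * l + 3) ^ 2)"
    using assms unfolding odd_poly_def even_poly_def
    by (intro top_coeff_cong[OF top_coeff_mult[OF _ top_coeff_power]]) (auto simp: algebra_simps)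
  moreover have "top_coeff h2 h3 (p * s ^ 2) (2 * (l + 2) * (l + 4) + 4 * (l + 1) * (l + 2))
      (of_nat (l + 1) * of_nat (2 * l + 5) ^ 2)"
    using assms unfolding odd_poly_def even_poly_def
    by (intro top_coeff_cong[OF top_coeff_mult[OF _ top_coeff_power]]) (auto simp: algebra_simps)
  ultimately have "top_coeff h2 h3 (t * q ^ 2 - p * s ^ 2)
      (2 * (l + 2) * (l + 4) + 4 * (l + 1) * (l + 2)) 2"
    by (intro top_coeff_cong[OF top_coeff_diff]) (auto simp: algebra_simps eval_nat_numeral)
  then have "top_coeff h2 h3 (r * (t * q ^ 2 - p * s ^ 2)) (2 * (2 * l + 3) * (2 * l + 3 + 2)) (of_nat (2 * l + 3 + 1))"
    using assms(3) unfolding even_poly_def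
    by (elim conjE) (drule (1) top_coeff_mult, erule top_coeff_cong, simp_all add: algebra_simps)
  moreover have "W (2 * (2 * l + 3) + 2) = w * poly (r * (t * q ^ 2 - p * s ^ 2)) (x 1)"
  proof -
    have "W (2 * (2 * l + 3) + 2) * w = W (2 * (l + 1) + 2) *
        (W (2 * (l + 2) + 2) * (W (2 * (l + 1) + 1))\<^sup>2 - W (2 * l + 2) * (W (2 * (l + 2) + 1))\<^sup>2)"
      using W_even[of "2 * l + 4"] assms(6) by (simp add: algebra_simps eval_nat_numeral)
    also have "\<dots> = (w * poly (r * (t * q ^ 2 - p * s ^ 2)) (x 1)) * w"
      using assms(1-5) unfolding odd_poly_def even_poly_def
      by (simp add: power_mult_distrib) (simp add: power2_eq_square algebra_simps)
    finally show ?thesis using w_nz by simp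
  qed
  ultimately show ?thesis unfolding even_poly_def by (rule conjI)
qed

lemma division_polynomials:
  "(2 * k + 1 \<le> N \<longrightarrow> (\<exists>p. odd_poly k p)) \<and> (2 * k + 2 \<le> N \<longrightarrow> (\<exists>p. even_poly k p))"
proof (induction k rule: less_induct)
  case (less k)
  consider "k = 0" | "k = 1" | l where "k = 2 * l + 2" | l where "k = 2 * l + 3"
  proof (cases "even k")
    case True
    then obtain m where "k = 2 * m" by (elim evenE)
    then show ?thesis using that(1) that(3)[of "m - 1"] by (cases m) auto
  next
    case False
    then obtain m where "k = 2 * m + 1" by (elim oddE)
    then show ?thesis using that(2) that(4)[of "m - 1"] by (cases m) auto
  qed
  then show ?case
  proof cases
    case 1
    then show ?thesis using odd_poly_0 even_poly_0 by blast
  next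
    case 2
    then show ?thesis using odd_poly_1 even_poly_1 by auto
  next
    case (3 l)
    have odd: "\<exists>p. odd_poly k p" if "2 * k + 1 \<le> N"
    proof -
      from 3 that less.IH[of l] less.IH[of "l + 1"] obtain p q r s
        where "odd_poly l p" "even_poly l q" "odd_poly (l + 1) r" "even_poly (l + 1) s" by auto
      from odd_poly_step_even[OF this] that 3 show ?thesis by auto
    qed
    moreover have "\<exists>p. even_poly k p" if "2 * k + 2 \<le> N"
    proof -
      from 3 that less.IH[of l] less.IH[of "l + 1"] obtain p q r s
        where "odd_poly l p" "even_poly l q" "odd_poly (l + 1) r" "even_poly (l + 1) s" by auto
      \<comment> \<open>For \<open>l = 0\<close> the recursion for \<open>W 6\<close> uses
        \<open>W 5\<close>, which belongs to the current \<open>k = 2\<close> and is not covered by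
        the induction hypothesis.\<close>
      moreover have "\<exists>t. odd_poly (l + 2) t"
      proof (cases "l = 0")
        case True
        then show ?thesis using odd that 3 by simp
      next
        case False
        then show ?thesis using less.IH[of "l + 2"] that 3 by auto
      qed
      then obtain t where "odd_poly (l + 2) t" ..
      ultimately show ?thesis using even_poly_step_odd[of l p q r s t] that 3 by auto
    qed
    ultimately show ?thesis by blast
  next
    case (4 l)
    have "\<exists>p. odd_poly k p" if "2 * k + 1 \<le> N"
    proof -
      from 4 that less.IH[of l] less.IH[of "l + 1"] less.IH[of "l + 2"] obtain p q r s
        where "even_poly l p" "odd_poly (l + 1) q" "even_poly (l + 1) r" "odd_poly (l + 2) s" by auto
      from odd_poly_step_odd[OF this] that 4 show ?thesis by auto
    qed
    moreover have "\<exists>p. even_poly k p" if "2 * k + 2 \<le> N"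
    proof -
      from 4 that less.IH[of l] less.IH[of "l + 1"] less.IH[of "l + 2"] obtain p q r s t
        where "even_poly l p" "odd_poly (l + 1) q" "even_poly (l + 1) r" "odd_poly (l + 2) s"
          "even_poly (l + 2) t" by auto
      from even_poly_step_even[OF this] that 4 show ?thesis by auto
    qed
    ultimately show ?thesis by blast
  qed
qed

lemma integral_multiple:
  assumes "N dvd m" "m > 0"
  shows "integral_over (int_poly2_ring h2 h3) (of_nat m * x 1)"
    and "even m \<Longrightarrow> integral_over (int_poly2_ring h2 h3) (of_nat (m div 2) * x 1)"
proof -
  have *: "\<exists>p d c. top_coeff h2 h3 p d (of_nat c) \<and> poly p (x 1) = 0 \<and> c > 0 \<and> c dvd m \<and>
    (even m \<longrightarrow> c dvd m div 2)"
  proof (cases "even N")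
    case True
    then obtain k where k: "N = 2 * k + 2"
      using N by (metis evenE mult_2 add_Suc_right Suc_1 add.commute plus_1_eq_Suc not0_implies_Suc
          mult_0_right not_numeral_le_zero mult_Suc_right)
    then obtain p where "even_poly k p" using division_polynomials[of k] by auto
    then have "top_coeff h2 h3 p (2 * k * (k + 2)) (of_nat (k + 1))" "poly p (x 1) = 0"
      using W_last w_nz k by (auto simp: even_poly_def)
    moreover have "k + 1 dvd m" "k + 1 dvd m div 2"
    proof -
      obtain i where "m = N * i" using assms(1) by (elim dvdE)
      then have "m = 2 * ((k + 1) * i)" using k by (simp add: algebra_simps)
      then have "m = (k + 1) * (2 * i)" "m div 2 = (k + 1) * i" by simp_all
      then show "k + 1 dvd m" "k + 1 dvd m div 2" by (metis dvd_triv_left)+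
    qed
    ultimately show ?thesis
      by (intro exI[of _ p] exI[of _ "2 * k * (k + 2)"] exI[of _ "k + 1"]) simp
  next
    case False
    then obtain k where k: "N = 2 * k + 1" by (elim oddE)
    then obtain p where "odd_poly k p" using division_polynomials[of k] by auto
    then have "top_coeff h2 h3 p (2 * k * (k + 1)) (of_nat N)" "poly p (x 1) = 0"
      using W_last k by (auto simp: odd_poly_def)
    moreover have "N dvd m div 2" if "even m"
      using assms(1) that False
      by (metis coprime_dvd_mult_right_iff coprime_right_2_iff_odd dvd_mult_div_cancel)
    ultimately show ?thesis using assms N
      by (intro exI[of _ p] exI[of _ "2 * k * (k + 1)"] exI[of _ N]) simp
  qed
  then obtain p d c where "top_coeff h2 h3 p d (of_nat c)" "poly p (x 1) = 0" "c > 0" "c dvd m"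
    "even m \<longrightarrow> c dvd m div 2" by blast
  then show "integral_over (int_poly2_ring h2 h3) (of_nat m * x 1)"
    and "even m \<Longrightarrow> integral_over (int_poly2_ring h2 h3) (of_nat (m div 2) * x 1)"
    using assms by (auto intro!: integral_over_of_root elim!: evenE)
qed

end

section \<open>Lattice sums\<close>

text \<open>The M-test gives uniform convergence along the filter of finite subsets; on each small
  disc a uniform limit of holomorphic functions is holomorphic.\<close>

lemma infsum_holomorphic_on:
  fixes f :: "'a \<Rightarrow> complex \<Rightarrow> complex"
  assumes "open S" and hol: "\<And>x. x \<in> A \<Longrightarrow> f x holomorphic_on S"
    and bound: "\<And>x z. x \<in> A \<Longrightarrow> z \<in> S \<Longrightarrow> norm (f x z) \<le> M x" and M: "M summable_on A"
  shows "(\<lambda>z. \<Sum>\<^sub>\<infinity>x\<in>A. f x z) holomorphic_on S"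
proof -
  let ?g = "\<lambda>z. \<Sum>\<^sub>\<infinity>x\<in>A. f x z"
  have lim: "uniform_limit S (\<lambda>X z. \<Sum>x\<in>X. f x z) ?g (finite_subsets_at_top A)"
    by (rule Weierstrass_m_test_general[OF bound M])
  have "?g field_differentiable at z" if "z \<in> S" for z
  proof -
    obtain r where r: "r > 0" "cball z r \<subseteq> S"
      using \<open>open S\<close> \<open>z \<in> S\<close> open_contains_cball by blast
    have lim': "uniform_limit (cball z r) (\<lambda>X z. \<Sum>x\<in>X. f x z) ?g (finite_subsets_at_top A)"
      using uniform_limit_on_subset[OF lim r(2)] .
    have ev: "\<forall>\<^sub>F X in finite_subsets_at_top A.
        continuous_on (cball z r) (\<lambda>z. \<Sum>x\<in>X. f x z) \<and> (\<lambda>z. \<Sum>x\<in>X. f x z) holomorphic_on ball z r"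
    proof (intro eventually_finite_subsets_at_top_weakI conjI)
      fix X assume "finite X" "X \<subseteq> A"
      then have holX: "(\<lambda>z. \<Sum>x\<in>X. f x z) holomorphic_on S"
        by (intro holomorphic_on_sum hol) auto
      show "continuous_on (cball z r) (\<lambda>z. \<Sum>x\<in>X. f x z)"
        by (rule holomorphic_on_imp_continuous_on[OF holomorphic_on_subset[OF holX r(2)]])
      show "(\<lambda>z. \<Sum>x\<in>X. f x z) holomorphic_on ball z r"
        by (rule holomorphic_on_subset[OF holX order_trans[OF ball_subset_cball r(2)]])
    qed
    have "?g holomorphic_on ball z r"
      using holomorphic_uniform_limit[OF ev lim' finite_subsets_at_top_neq_bot] by blast
    then show ?thesis
      using r(1) by (intro holomorphic_on_imp_differentiable_at[of ?g "ball z r"]) auto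
  qed
  then show ?thesis using \<open>open S\<close>
    by (simp add: holomorphic_on_def field_differentiable_at_within)
qed

lemma summable_on_int_powr:
  fixes s :: real assumes "s > 1"
  shows "(\<lambda>a::int. (1 + \<bar>of_int a\<bar>) powr - s) summable_on UNIV"
proof -
  have "summable (\<lambda>n::nat. real n powr - s)"
    using assms by (subst summable_real_powr_iff) auto
  then have "summable (\<lambda>n::nat. real (Suc n) powr - s)"
    by (subst summable_Suc_iff)
  then have "summable (\<lambda>n::nat. norm ((1 + \<bar>of_int (int n)\<bar>) powr - s))"
    by (simp add: add.commute)
  then have nat: "(\<lambda>n::nat. (1 + \<bar>of_int (int n)\<bar>) powr - s) summable_on UNIV"
    by (rule norm_summable_imp_summable_on)
  have "(\<lambda>a::int. (1 + \<bar>of_int a\<bar>) powr - s) summable_on range int"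
    by (subst summable_on_reindex) (use nat in \<open>simp_all add: o_def\<close>)
  moreover have "(\<lambda>a::int. (1 + \<bar>of_int a\<bar>) powr - s) summable_on range (\<lambda>n. - int n)"
    by (subst summable_on_reindex) (use nat in \<open>simp_all add: o_def inj_on_def\<close>)
  ultimately have "(\<lambda>a::int. (1 + \<bar>of_int a\<bar>) powr - s) summable_on range int \<union> range (\<lambda>n. - int n)"
    by (rule summable_on_union)
  moreover have "range int \<union> range (\<lambda>n. - int n) = UNIV"
    by (auto simp: image_iff) (metis int_cases2)
  ultimately show ?thesis by simp
qed

locale complex_lattice =
  fixes L :: "complex set"
  assumes is_lattice: "is_lattice L"
begin

lemma zero_in: "0 \<in> L"
  and add_in: "x \<in> L \<Longrightarrow> y \<in> L \<Longrightarrow> x + y \<in> L"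
  and uminus_in: "x \<in> L \<Longrightarrow> - x \<in> L"
proof -
  obtain w1 w2 where L: "L = lattice_of w1 w2" using is_lattice by (auto simp: is_lattice_def)
  show "0 \<in> L" unfolding L lattice_of_def mem_Collect_eq by (intro exI[of _ 0]) simp
  show "x + y \<in> L" if x: "x \<in> L" and y: "y \<in> L"
  proof -
    obtain a b c d :: int where "x = of_int a * w1 + of_int b * w2" "y = of_int c * w1 + of_int d * w2"
      using x y unfolding L lattice_of_def by blast
    then have "x + y = of_int (a + c) * w1 + of_int (b + d) * w2"
      by (simp add: algebra_simps)
    then show ?thesis unfolding L lattice_of_def by blast
  qed
  show "- x \<in> L" if x: "x \<in> L"
  proof -
    obtain a b :: int where "x = of_int a * w1 + of_int b * w2"
      using x unfolding L lattice_of_def by blast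
    then have "- x = of_int (- a) * w1 + of_int (- b) * w2" by simp
    then show ?thesis unfolding L lattice_of_def by blast
  qed
qed

lemma uminus_in_iff [simp]: "- x \<in> L \<longleftrightarrow> x \<in> L"
  using uminus_in[of x] uminus_in[of "- x"] by auto

lemma diff_in: "x \<in> L \<Longrightarrow> y \<in> L \<Longrightarrow> x - y \<in> L"
  using add_in[of x "- y"] by simp

lemma add_in_iff: "y \<in> L \<Longrightarrow> x + y \<in> L \<longleftrightarrow> x \<in> L"
  using add_in[of x y] diff_in[of "x + y" y] by auto

lemma of_nat_mult_in: "x \<in> L \<Longrightarrow> of_nat n * x \<in> L"
  by (induction n) (auto simp: zero_in algebra_simps intro: add_in)

text \<open>A quantitative form of the linear independence of the periods: finiteness of bounded
  parts, uniqueness of coordinates and convergence of the lattice sums all rest on the bound by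
  \<open>C\<close>.\<close>

lemma lattice_coordinates:
  obtains w1 w2 :: complex and C :: real
  where "L = lattice_of w1 w2" "C > 0"
    "\<And>a b :: real. max \<bar>a\<bar> \<bar>b\<bar> \<le> C * norm (of_real a * w1 + of_real b * w2)"
    "\<And>z. \<exists>a b :: real. z = of_real a * w1 + of_real b * w2"
proof -
  obtain w1 w2 where L: "L = lattice_of w1 w2" and im: "Im (w2 / w1) \<noteq> 0"
    using is_lattice by (auto simp: is_lattice_def)
  define \<tau> where "\<tau> = w2 / w1"
  have w1: "w1 \<noteq> 0" using im by auto
  have w2: "w2 = \<tau> * w1" using w1 by (simp add: \<tau>_def)
  have im: "\<bar>Im \<tau>\<bar> > 0" using im by (simp add: \<tau>_def)
  \<comment> \<open>For \<open>z / w1 = a + b \<tau>\<close> one has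
    \<open>|b| <= |z / w1| / |Im \<tau>|\<close> and
    \<open>|a| <= |z / w1| (1 + |\<tau>| / |Im \<tau>|)\<close>; \<open>C\<close> dominates both
    factors and includes the rescaling by \<open>w1\<close>.\<close>
  define C where "C = (1 + (1 + norm \<tau>) / \<bar>Im \<tau>\<bar>) / norm w1"
  have bound: "max \<bar>a\<bar> \<bar>b\<bar> \<le> C * norm (of_real a * w1 + of_real b * w2)" for a b :: real
  proof -
    let ?z = "of_real a + of_real b * \<tau>"
    have z: "norm (of_real a * w1 + of_real b * w2) = norm ?z * norm w1"
      unfolding w2 norm_mult[symmetric] by (simp add: algebra_simps)
    have "\<bar>b\<bar> * \<bar>Im \<tau>\<bar> \<le> norm ?z"
      using abs_Im_le_cmod[of ?z] by (simp add: abs_mult)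
    then have b: "\<bar>b\<bar> \<le> norm ?z / \<bar>Im \<tau>\<bar>" using im by (simp add: field_simps)
    have "\<bar>a\<bar> = norm (?z - of_real b * \<tau>)" by simp
    also have "\<dots> \<le> norm ?z + norm (of_real b * \<tau>)" by (rule norm_triangle_ineq4)
    also have "\<dots> = norm ?z + \<bar>b\<bar> * norm \<tau>" by (simp add: norm_mult)
    also have "\<dots> \<le> norm ?z + norm ?z / \<bar>Im \<tau>\<bar> * norm \<tau>"
      using b by (intro add_left_mono mult_right_mono) auto
    finally have a: "\<bar>a\<bar> \<le> norm ?z * (1 + norm \<tau> / \<bar>Im \<tau>\<bar>)" by (simp add: algebra_simps)
    have "max \<bar>a\<bar> \<bar>b\<bar> \<le> norm ?z * (1 + (1 + norm \<tau>) / \<bar>Im \<tau>\<bar>)"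
    proof (rule max.boundedI)
      have "norm ?z * (1 + norm \<tau> / \<bar>Im \<tau>\<bar>) \<le> norm ?z * (1 + (1 + norm \<tau>) / \<bar>Im \<tau>\<bar>)"
        using im by (intro mult_left_mono add_left_mono divide_right_mono) auto
      then show "\<bar>a\<bar> \<le> norm ?z * (1 + (1 + norm \<tau>) / \<bar>Im \<tau>\<bar>)" using a by linarith
      have "norm ?z * (1 / \<bar>Im \<tau>\<bar>) \<le> norm ?z * (1 + (1 + norm \<tau>) / \<bar>Im \<tau>\<bar>)"
        using im by (intro mult_left_mono) (auto simp: add_divide_distrib intro: add_increasing)
      then show "\<bar>b\<bar> \<le> norm ?z * (1 + (1 + norm \<tau>) / \<bar>Im \<tau>\<bar>)" using b by simp
    qed
    then show ?thesis unfolding z C_def using w1 by (simp add: mult_ac)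
  qed
  have span: "\<exists>a b :: real. z = of_real a * w1 + of_real b * w2" for z
  proof -
    define b where "b = Im (z / w1) / Im \<tau>"
    define a where "a = Re (z / w1) - b * Re \<tau>"
    have "z / w1 = of_real a + of_real b * \<tau>"
      using im by (simp add: complex_eq_iff a_def b_def)
    then have "z = of_real a * w1 + of_real b * w2" using w1 by (simp add: w2 field_simps)
    then show ?thesis by blast
  qed
  have "C > 0" unfolding C_def using im w1 by (intro divide_pos_pos add_pos_nonneg) auto
  from that[OF L this bound span] show thesis .
qed

lemma cocompact: obtains B where "B > 0" "\<And>z. \<exists>w\<in>L. norm (z - w) \<le> B"
proof -
  obtain w1 w2 C where L: "L = lattice_of w1 w2"
    and span: "\<And>z. \<exists>a b :: real. z = of_real a * w1 + of_real b * w2"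
    using lattice_coordinates by metis
  have "\<exists>w\<in>L. norm (z - w) \<le> norm w1 + norm w2 + 1" for z
  proof -
    obtain a b :: real where z: "z = of_real a * w1 + of_real b * w2" using span by blast
    define w where "w = of_int \<lfloor>a\<rfloor> * w1 + of_int \<lfloor>b\<rfloor> * w2"
    have "w \<in> L" unfolding L w_def lattice_of_def by blast
    have "z - w = of_real (frac a) * w1 + of_real (frac b) * w2"
      by (simp add: z w_def frac_def algebra_simps)
    also have "norm \<dots> \<le> norm (of_real (frac a) * w1) + norm (of_real (frac b) * w2)"
      by (rule norm_triangle_ineq)
    also have "\<dots> \<le> 1 * norm w1 + 1 * norm w2"
      unfolding norm_mult by (intro add_mono mult_right_mono) (auto simp: frac_lt_1 less_imp_le)
    finally show ?thesis using \<open>w \<in> L\<close> by force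
  qed
  moreover have "norm w1 + norm w2 + 1 > 0" by (simp add: add_nonneg_pos)
  ultimately show thesis using that by blast
qed

lemma finite_bounded: "finite {w \<in> L. norm w \<le> R}"
proof -
  obtain w1 w2 C where L: "L = lattice_of w1 w2" and C: "C > 0"
    and bound: "\<And>a b :: real. max \<bar>a\<bar> \<bar>b\<bar> \<le> C * norm (of_real a * w1 + of_real b * w2)"
    using lattice_coordinates by metis
  let ?K = "\<lceil>C * R\<rceil>"
  have "{w \<in> L. norm w \<le> R} \<subseteq> (\<lambda>(a, b). of_int a * w1 + of_int b * w2) ` ({- ?K..?K} \<times> {- ?K..?K})"
  proof
    fix w assume w: "w \<in> {w \<in> L. norm w \<le> R}"
    then obtain a b :: int where ab: "w = of_int a * w1 + of_int b * w2"
      unfolding L lattice_of_def by blast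
    have "max \<bar>real_of_int a\<bar> \<bar>real_of_int b\<bar> \<le> C * norm w"
      using bound[of "of_int a" "of_int b"] by (simp add: ab)
    also have "\<dots> \<le> C * R" using w C by simp
    also have "\<dots> \<le> of_int ?K" by simp
    finally have "\<bar>a\<bar> \<le> ?K" "\<bar>b\<bar> \<le> ?K" by linarith+
    then show "w \<in> (\<lambda>(a, b). of_int a * w1 + of_int b * w2) ` ({- ?K..?K} \<times> {- ?K..?K})"
      unfolding ab by (intro image_eqI[of _ _ "(a, b)"]) auto
  qed
  then show ?thesis by (rule finite_subset) auto
qed

lemma summable_inverse_cube: "(\<lambda>w. 1 / norm w ^ 3) summable_on L"
proof -
  obtain w1 w2 C where L: "L = lattice_of w1 w2" and C: "C > 0"
    and bound: "\<And>a b :: real. max \<bar>a\<bar> \<bar>b\<bar> \<le> C * norm (of_real a * w1 + of_real b * w2)"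
    using lattice_coordinates by metis
  define g :: "int \<times> int \<Rightarrow> complex" where "g = (\<lambda>(a, b). of_int a * w1 + of_int b * w2)"
  have gb: "max \<bar>of_int a\<bar> \<bar>of_int b\<bar> \<le> C * norm (g (a, b))" for a b
    using bound[of "of_int a" "of_int b"] by (simp add: g_def)
  have inj: "inj g"
  proof (rule injI)
    fix p q :: "int \<times> int" assume eq: "g p = g q"
    obtain a b c d where pq: "p = (a, b)" "q = (c, d)" by (cases p; cases q) auto
    have "g (a - c, b - d) = 0" using eq by (simp add: g_def pq algebra_simps)
    then have "max \<bar>real_of_int (a - c)\<bar> \<bar>real_of_int (b - d)\<bar> \<le> 0"
      using gb[of "a - c" "b - d"] by simp
    then show "p = q" by (auto simp: pq)
  qed
  \<comment> \<open>Since \<open>|w|\<close> dominates the larger coordinate, \<open>|w|^3\<close>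
    dominates, up to a constant, \<open>((1 + |a|) (1 + |b|)) powr (3/2)\<close>. The double sum
    then splits into two single sums with exponent 3/2 > 1.\<close>
  let ?f = "\<lambda>a::int. (1 + \<bar>of_int a\<bar> :: real) powr - (3 / 2)"
  have f: "?f summable_on UNIV" by (rule summable_on_int_powr) simp
  have "(\<lambda>(a, b). ?f a * ?f b) summable_on UNIV \<times> UNIV"
  proof (rule summable_on_SigmaI)
    show "((\<lambda>b. case (a, b) of (a, b) \<Rightarrow> ?f a * ?f b) has_sum ?f a * infsum ?f UNIV) UNIV" for a
      using has_sum_cmult_right[OF has_sum_infsum[OF f]] by simp
    show "(\<lambda>a. ?f a * infsum ?f UNIV) summable_on UNIV"
      by (rule summable_on_cmult_left[OF f])
  qed auto
  then have M: "(\<lambda>p. (2 * C) ^ 3 * (case p of (a, b) \<Rightarrow> ?f a * ?f b)) summable_on UNIV"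
    by (intro summable_on_cmult_right) simp
  have le: "1 / norm (g (a, b)) ^ 3 \<le> (2 * C) ^ 3 * (?f a * ?f b)" for a b
  proof (cases "a = 0 \<and> b = 0")
    case True
    then show ?thesis using C by (simp add: g_def)
  next
    case False
    let ?m = "max \<bar>real_of_int a\<bar> \<bar>real_of_int b\<bar>"
    have m: "?m \<ge> 1" using False by (auto simp: max_def)
    have "(1 + \<bar>of_int a\<bar>) * (1 + \<bar>of_int b\<bar>) \<le> (2 * ?m) * (2 * ?m)"
      using m by (intro mult_mono) auto
    also have "\<dots> \<le> (2 * (C * norm (g (a, b)))) * (2 * (C * norm (g (a, b))))"
      using gb[of a b] m by (intro mult_mono) auto
    finally have le: "(1 + \<bar>of_int a\<bar>) * (1 + \<bar>of_int b\<bar>) \<le> (2 * C * norm (g (a, b))) powr 2"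
      using C by (simp add: power2_eq_square)
    have pos: "norm (g (a, b)) > 0" using gb[of a b] m C by (cases "g (a, b) = 0") auto
    have "1 / (2 * C * norm (g (a, b))) ^ 3 = (2 * C * norm (g (a, b))) powr - 3"
      using pos C by (simp add: powr_minus divide_inverse)
    also have "\<dots> = ((2 * C * norm (g (a, b))) powr 2) powr - (3 / 2)"
      by (subst powr_powr) simp
    also have "\<dots> \<le> ((1 + \<bar>of_int a\<bar>) * (1 + \<bar>of_int b\<bar>)) powr - (3 / 2)"
      using le by (intro powr_mono2') (auto intro: mult_pos_pos)
    also have "\<dots> = ?f a * ?f b" by (simp add: powr_mult)
    finally show ?thesis using C pos by (simp add: field_simps power_mult_distrib)
  qed
  have "(\<lambda>p. 1 / norm (g p) ^ 3) summable_on UNIV"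
    by (rule summable_on_comparison_test[OF M]) (use le in auto)
  then have "(\<lambda>w. 1 / norm w ^ 3) summable_on range g"
    using inj by (subst summable_on_reindex) (simp_all add: o_def)
  moreover have "range g = L"
    unfolding L lattice_of_def g_def by (auto simp: image_iff)
  ultimately show ?thesis by simp
qed

end

section \<open>The Weierstrass function\<close>

context complex_lattice
begin

lemma norm_lower_bound: obtains \<delta> where "\<delta> > 0" "\<And>w. w \<in> L \<Longrightarrow> w \<noteq> 0 \<Longrightarrow> norm w \<ge> \<delta>"
proof -
  let ?N = "norm ` ({w \<in> L. norm w \<le> 1} - {0})"
  have fin: "finite (insert 1 ?N)" using finite_bounded[of 1] by auto
  define \<delta> where "\<delta> = Min (insert 1 ?N)"
  have "\<delta> > 0" unfolding \<delta>_def using fin by (subst Min_gr_iff) auto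
  moreover have "norm w \<ge> \<delta>" if "w \<in> L" "w \<noteq> 0" for w
  proof (cases "norm w \<le> 1")
    case True
    then show ?thesis unfolding \<delta>_def using that fin by (intro Min_le) auto
  next
    case False
    have "\<delta> \<le> 1" unfolding \<delta>_def using fin by (intro Min_le) auto
    then show ?thesis using False by simp
  qed
  ultimately show thesis using that by blast
qed

lemma closed_L: "closed L"
proof -
  obtain \<delta> where \<delta>: "\<delta> > 0" "\<And>w. w \<in> L \<Longrightarrow> w \<noteq> 0 \<Longrightarrow> norm w \<ge> \<delta>"
    using norm_lower_bound by blast
  have "\<forall>x\<in>L. \<forall>y\<in>L. dist y x < \<delta> \<longrightarrow> y = x"
    using \<delta>(2) diff_in by (fastforce simp: dist_norm)
  then show ?thesis by (rule discrete_imp_closed[OF \<delta>(1)])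
qed

lemma summable_comparison:
  fixes f :: "complex \<Rightarrow> complex"
  assumes "A \<subseteq> L" "\<And>w. w \<in> A \<Longrightarrow> norm (f w) \<le> c / norm w ^ 3"
  shows "f summable_on A"
proof -
  have "(\<lambda>w. c * (1 / norm w ^ 3)) summable_on A"
    by (intro summable_on_cmult_right summable_on_subset[OF summable_inverse_cube assms(1)])
  then have "(\<lambda>w. norm (f w)) summable_on A"
    by (rule summable_on_comparison_test) (use assms(2) in auto)
  then show ?thesis by (rule abs_summable_summable)
qed

text \<open>The difference equals \<open>z (2 w - z) / (w^2 (z - w)^2)\<close>. With
  \<open>|2 w - z| <= 5/2 |w|\<close> and \<open>|z - w| >= |w| / 2\<close> the constant is
  \<open>4 * 5/2 = 10\<close>.\<close>

lemma wp_term_bound: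
  fixes z w :: complex
  assumes "norm z \<le> r" "2 * r \<le> norm w" "r > 0"
  shows "norm (1 / (z - w)\<^sup>2 - 1 / w\<^sup>2) \<le> 10 * r / norm w ^ 3"
proof -
  have w: "norm w > 0" using assms by linarith
  have zw: "norm (z - w) \<ge> norm w / 2"
    using norm_triangle_ineq2[of w z] assms by (simp add: norm_minus_commute)
  then have nz: "z - w \<noteq> 0" using w by auto
  have "norm (2 * w - z) \<le> 2 * norm w + norm z"
    using norm_triangle_ineq4[of "2 * w" z] by simp
  then have num: "norm (2 * w - z) \<le> 5 / 2 * norm w" using assms by simp
  have "1 / (z - w)\<^sup>2 - 1 / w\<^sup>2 = z * (2 * w - z) / (w\<^sup>2 * (z - w)\<^sup>2)"
    using nz w by (simp add: divide_simps) (simp add: algebra_simps power2_eq_square)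
  also have "norm \<dots> = norm z * norm (2 * w - z) / ((norm w)\<^sup>2 * (norm (z - w))\<^sup>2)"
    by (simp add: norm_mult norm_divide norm_power)
  also have "\<dots> \<le> r * (5 / 2 * norm w) / ((norm w)\<^sup>2 * (norm w / 2)\<^sup>2)"
    using assms num zw w by (intro frac_le mult_mono mult_pos_pos power_mono) auto
  also have "\<dots> = 10 * r / norm w ^ 3"
    using w by (simp add: field_simps power2_eq_square power3_eq_cube)
  finally show ?thesis .
qed

lemma wp_tail:
  assumes "r > 0"
  shows "(\<lambda>w. 1 / (z - w)\<^sup>2 - 1 / w\<^sup>2) summable_on L" (is ?sum)
    and "(\<lambda>z. \<Sum>\<^sub>\<infinity>w\<in>{w \<in> L. 2 * r \<le> norm w}. 1 / (z - w)\<^sup>2 - 1 / w\<^sup>2) holomorphic_on ball 0 r"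
proof -
  define s where "s = norm z + 1"
  have "(\<lambda>w. 1 / (z - w)\<^sup>2 - 1 / w\<^sup>2) summable_on {w \<in> L. norm w \<le> 2 * s} \<union> {w \<in> L. 2 * s \<le> norm w}"
    using wp_term_bound[of z s]
    by (intro summable_on_union summable_on_finite finite_bounded
        summable_comparison[where c = "10 * s"]) (auto simp: s_def add_nonneg_pos)
  moreover have "{w \<in> L. norm w \<le> 2 * s} \<union> {w \<in> L. 2 * s \<le> norm w} = L" by auto
  ultimately show ?sum by simp
  show "(\<lambda>z. \<Sum>\<^sub>\<infinity>w\<in>{w \<in> L. 2 * r \<le> norm w}. 1 / (z - w)\<^sup>2 - 1 / w\<^sup>2) holomorphic_on ball 0 r"
  proof (rule infsum_holomorphic_on)
    show "(\<lambda>w. (10 * r) * (1 / norm w ^ 3)) summable_on {w \<in> L. 2 * r \<le> norm w}"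
      by (intro summable_on_cmult_right summable_on_subset[OF summable_inverse_cube]) auto
    show "norm (1 / (z - w)\<^sup>2 - 1 / w\<^sup>2) \<le> (10 * r) * (1 / norm w ^ 3)"
      if "w \<in> {w \<in> L. 2 * r \<le> norm w}" "z \<in> ball 0 r" for w z
      using wp_term_bound[of z r w] that assms by simp
    show "(\<lambda>z. 1 / (z - w)\<^sup>2 - 1 / w\<^sup>2) holomorphic_on ball 0 r"
      if "w \<in> {w \<in> L. 2 * r \<le> norm w}" for w
      using that assms by (intro holomorphic_intros) auto
  qed simp
qed

lemma wp_summable: "(\<lambda>w. 1 / (z - w)\<^sup>2 - 1 / w\<^sup>2) summable_on L"
  using wp_tail(1)[of 1 z] by simp

text \<open>As \<open>1 / 0 = 0\<close>, the summand at \<open>w = 0\<close> is \<open>1 / z\<^sup>2\<close>, and the sum runs over the whole lattice.\<close>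

lemma wp_has_sum: "((\<lambda>w. 1 / (z - w)\<^sup>2 - 1 / w\<^sup>2) has_sum wp L z) L"
proof -
  have "infsum (\<lambda>w. 1 / (z - w)\<^sup>2 - 1 / w\<^sup>2) (insert 0 (L - {0})) = wp L z"
    unfolding wp_def
    by (subst infsum_insert) (auto intro: summable_on_subset[OF wp_summable])
  moreover have "insert 0 (L - {0}) = L" using zero_in by auto
  ultimately show ?thesis using wp_summable[of z] by (simp add: has_sum_iff)
qed

lemma wp_uminus: "wp L (- z) = wp L z"
proof -
  have "bij_betw uminus L L" by (rule bij_betwI[of _ _ _ uminus]) auto
  then have "((\<lambda>w. 1 / (z - - w)\<^sup>2 - 1 / (- w)\<^sup>2) has_sum wp L z) L"
    using wp_has_sum[of z] by (subst has_sum_reindex_bij_betw)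
  then have "((\<lambda>w. 1 / (- z - w)\<^sup>2 - 1 / w\<^sup>2) has_sum wp L z) L"
    by (simp add: power2_eq_square algebra_simps)
  then show ?thesis using wp_has_sum has_sum_unique by blast
qed

text \<open>After shifting the index, \<open>\<wp> (z + v) - \<wp> z\<close> is a sum not involving \<open>z\<close>; it vanishes at
  \<open>z = - v / 2\<close> because \<open>\<wp>\<close> is even.\<close>

lemma wp_periodic:
  assumes "v \<in> L"
  shows "wp L (z + v) = wp L z"
proof -
  have "bij_betw (\<lambda>w. w + v) L L"
    by (rule bij_betwI[of _ _ _ "\<lambda>w. w - v"]) (use assms in \<open>auto intro: add_in diff_in\<close>)
  then have shift: "((\<lambda>w. 1 / (y + v - (w + v))\<^sup>2 - 1 / (w + v)\<^sup>2) has_sum wp L (y + v)) L" for y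
    using wp_has_sum[of "y + v"] by (subst has_sum_reindex_bij_betw)
  have "((\<lambda>w. 1 / w\<^sup>2 - 1 / (w + v)\<^sup>2) has_sum wp L (y + v) - wp L y) L" for y
    using has_sum_add[OF shift[of y] has_sum_uminusI[OF wp_has_sum[of y]]] by simp
  \<comment> \<open>The point \<open>- v / 2\<close> may itself lie in \<open>L\<close>; the
    convention \<open>1 / 0 = 0\<close> makes both the sum formula and evenness valid there
    too.\<close>
  then have "wp L (z + v) - wp L z = wp L (- v / 2 + v) - wp L (- v / 2)"
    using has_sum_unique by blast
  moreover have "- v / 2 + v = v / 2" by simp
  ultimately show ?thesis using wp_uminus[of "v / 2"] by simp
qed

text \<open>On a disc only finitely many terms escape the uniform bound. They form \<open>F\<close>
  and are rational functions; the rest is the tail of \<open>wp_tail\<close>.\<close>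

lemma wp_holomorphic: "wp L holomorphic_on - L"
proof -
  have "wp L field_differentiable at z" if z: "z \<notin> L" for z
  proof -
    define r where "r = norm z + 1"
    have r: "r > 0" "z \<in> ball 0 r" by (auto simp: r_def add_nonneg_pos)
    let ?t = "\<lambda>z w. 1 / (z - w)\<^sup>2 - 1 / w\<^sup>2"
    define F T where "F = {w \<in> L. norm w < 2 * r}" and "T = {w \<in> L. 2 * r \<le> norm w}"
    have F: "finite F" unfolding F_def by (rule finite_subset[OF _ finite_bounded[of "2 * r"]]) auto
    have FT: "L = F \<union> T" "F \<inter> T = {}" by (auto simp: F_def T_def)
    have split: "wp L y = (\<Sum>w\<in>F. ?t y w) + infsum (?t y) T" for y
    proof -
      have "wp L y = infsum (?t y) (F \<union> T)" using infsumI[OF wp_has_sum[of y]] FT(1) by simp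
      also have "\<dots> = infsum (?t y) F + infsum (?t y) T"
        by (intro infsum_Un_disjoint FT summable_on_subset[OF wp_summable]) (auto simp: F_def T_def)
      finally show ?thesis using F by simp
    qed
    have "(\<lambda>y. (\<Sum>w\<in>F. ?t y w) + infsum (?t y) T) holomorphic_on ball 0 r - L"
      unfolding T_def
      by (intro holomorphic_intros holomorphic_on_subset[OF wp_tail(2)[OF r(1)]]) (auto simp: F_def)
    then have "wp L holomorphic_on ball 0 r - L"
      by (subst holomorphic_cong[OF refl split])
    then show ?thesis
      using r z closed_L by (intro holomorphic_on_imp_differentiable_at[of _ "ball 0 r - L"]) auto
  qed
  then show ?thesis by (auto simp: holomorphic_on_def field_differentiable_at_within)
qed

text \<open>Pairing \<open>w\<close> with \<open>- w\<close> gives the Laurent expansion with an explicit lattice sum \<open>K\<close> as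
  remainder, so no termwise differentiation is needed.\<close>

lemma wp_expansion:
  obtains K \<rho> where "\<rho> > 0" "K holomorphic_on ball 0 \<rho>" "K 0 = g3 L / 28"
    "\<And>z. z \<in> ball 0 \<rho> - {0} \<Longrightarrow> z \<notin> L \<and> wp L z = 1 / z\<^sup>2 + g2 L / 20 * z\<^sup>2 + z ^ 4 * K z"
proof -
  obtain \<delta> where \<delta>: "\<delta> > 0" "\<And>w. w \<in> L \<Longrightarrow> w \<noteq> 0 \<Longrightarrow> norm w \<ge> \<delta>"
    using norm_lower_bound by blast
  define \<rho> where "\<rho> = \<delta> / 2"
  let ?A = "L - {0}"
  \<comment> \<open>The terms for \<open>w\<close> and \<open>- w\<close> add up to
    \<open>(6 w^2 z^2 - 2 z^4) / (w^2 (w^2 - z^2)^2)\<close>. Subtracting \<open>6 z^2 / w^4\<close>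
    and dividing by \<open>2 z^4\<close> leaves \<open>?k w z\<close>.\<close>
  let ?k = "\<lambda>w z. (5 * w\<^sup>2 - 3 * z\<^sup>2) / (w ^ 4 * (w\<^sup>2 - z\<^sup>2)\<^sup>2)"
  define K where "K z = infsum (\<lambda>w. ?k w z) ?A" for z
  have \<rho>: "\<rho> > 0" using \<delta>(1) by (simp add: \<rho>_def)
  have sq: "norm (w\<^sup>2 - z\<^sup>2) \<ge> 3 / 4 * (norm w)\<^sup>2" "(norm z)\<^sup>2 \<le> (norm w)\<^sup>2 / 4" "norm w > 0" "norm w \<ge> \<delta>"
    if "w \<in> ?A" "z \<in> ball 0 \<rho>" for w z
  proof -
    show w: "norm w \<ge> \<delta>" using that \<delta>(2) by auto
    then show "norm w > 0" using \<delta>(1) by linarith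
    have "norm z \<le> norm w / 2" using that w by (simp add: \<rho>_def)
    then have "(norm z)\<^sup>2 \<le> (norm w / 2)\<^sup>2" by (intro power_mono) auto
    then show z: "(norm z)\<^sup>2 \<le> (norm w)\<^sup>2 / 4" by (simp add: power2_eq_square)
    show "norm (w\<^sup>2 - z\<^sup>2) \<ge> 3 / 4 * (norm w)\<^sup>2"
      using norm_triangle_ineq2[of "w\<^sup>2" "z\<^sup>2"] z by (simp add: norm_power)
  qed
  \<comment> \<open>The numerator is at most \<open>(5 + 3/4) |w|^2 <= 6 |w|^2\<close>, and
    \<open>6 / (3/4)^2 = 32/3 <= 12\<close>. Three of the six powers of \<open>|w|\<close> are
    traded for \<open>\<delta>\<close>, so that the inverse cube sum suffices.\<close>
  have bound: "norm (?k w z) \<le> (12 / \<delta> ^ 3) / norm w ^ 3" if wz: "w \<in> ?A" "z \<in> ball 0 \<rho>" for w z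
  proof -
    note s = sq[OF wz]
    have "norm (5 * w\<^sup>2 - 3 * z\<^sup>2) \<le> 5 * (norm w)\<^sup>2 + 3 * (norm z)\<^sup>2"
      using norm_triangle_ineq4[of "5 * w\<^sup>2" "3 * z\<^sup>2"] by (simp add: norm_mult norm_power)
    then have num: "norm (5 * w\<^sup>2 - 3 * z\<^sup>2) \<le> 6 * (norm w)\<^sup>2"
      using s(2) zero_le_power2[of "norm w"] by linarith
    have "norm (?k w z) = norm (5 * w\<^sup>2 - 3 * z\<^sup>2) / (norm w ^ 4 * (norm (w\<^sup>2 - z\<^sup>2))\<^sup>2)"
      by (simp add: norm_mult norm_divide norm_power)
    also have "\<dots> \<le> (6 * (norm w)\<^sup>2) / (norm w ^ 4 * (3 / 4 * (norm w)\<^sup>2)\<^sup>2)"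
      using num s by (intro frac_le mult_left_mono power_mono mult_pos_pos) auto
    also have "\<dots> = (32 / 3) / (norm w ^ 3 * norm w ^ 3)"
      using s(3) by (simp add: field_simps eval_nat_numeral)
    also have "\<dots> \<le> 12 / (\<delta> ^ 3 * norm w ^ 3)"
      using s(3,4) \<delta>(1) by (intro frac_le mult_right_mono power_mono mult_pos_pos) auto
    finally show ?thesis by simp
  qed
  have k_sum: "(\<lambda>w. ?k w z) summable_on ?A" if "z \<in> ball 0 \<rho>" for z
    using bound that by (intro summable_comparison[where c = "12 / \<delta> ^ 3"]) auto
  have hol: "K holomorphic_on ball 0 \<rho>"
    unfolding K_def
  proof (rule infsum_holomorphic_on)
    show "(\<lambda>w. (12 / \<delta> ^ 3) * (1 / norm w ^ 3)) summable_on ?A"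
      by (intro summable_on_cmult_right summable_on_subset[OF summable_inverse_cube]) auto
    show "norm (?k w z) \<le> (12 / \<delta> ^ 3) * (1 / norm w ^ 3)" if "w \<in> ?A" "z \<in> ball 0 \<rho>" for w z
      using bound[OF that] by simp
    show "?k w holomorphic_on ball 0 \<rho>" if w: "w \<in> ?A" for w
    proof -
      have "w ^ 4 * (w\<^sup>2 - z\<^sup>2)\<^sup>2 \<noteq> 0" if "z \<in> ball 0 \<rho>" for z
        using sq[OF w that] w by auto
      then show ?thesis by (intro holomorphic_intros) auto
    qed
  qed simp
  have K0: "K 0 = g3 L / 28"
  proof -
    have "K 0 = (\<Sum>\<^sub>\<infinity>w\<in>?A. 5 * (1 / w ^ 6))"
      unfolding K_def by (intro infsum_cong) (simp add: field_simps eval_nat_numeral)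
    also have "\<dots> = 5 * (\<Sum>\<^sub>\<infinity>w\<in>?A. 1 / w ^ 6)" by (rule infsum_cmult_right')
    finally show ?thesis by (simp add: g3_def)
  qed
  have g_sum: "(\<lambda>w. 1 / w ^ 4) summable_on ?A"
  proof (rule summable_comparison[where c = "1 / \<delta>"])
    fix w assume "w \<in> ?A"
    then have w: "norm w \<ge> \<delta>" "norm w > 0" using \<delta>(2) by auto
    then have "1 / norm w ^ 4 \<le> 1 / (\<delta> * norm w ^ 3)"
      using \<delta>(1) by (intro divide_left_mono mult_pos_pos) (auto simp: eval_nat_numeral intro!: mult_right_mono)
    then show "norm (1 / w ^ 4) \<le> 1 / \<delta> / norm w ^ 3" by (simp add: norm_divide norm_power)
  qed auto
  have "z \<notin> L \<and> wp L z = 1 / z\<^sup>2 + g2 L / 20 * z\<^sup>2 + z ^ 4 * K z" if z: "z \<in> ball 0 \<rho> - {0}" for z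
  proof
    show "z \<notin> L" using z \<delta>(2)[of z] \<delta>(1) by (auto simp: \<rho>_def)
    define E where "E = wp L z - 1 / z\<^sup>2"
    let ?t = "\<lambda>w. 1 / (z - w)\<^sup>2 - 1 / w\<^sup>2"
    have t: "(?t has_sum E) ?A"
      using summable_on_subset[OF wp_summable[of z], of ?A] by (simp add: E_def wp_def has_sum_infsum)
    have t': "((\<lambda>w. ?t (- w)) has_sum E) ?A"
    proof -
      have "bij_betw uminus ?A ?A" by (rule bij_betwI[of _ _ _ uminus]) auto
      then show ?thesis using t by (subst has_sum_reindex_bij_betw[of uminus ?A ?A ?t])
    qed
    have "((\<lambda>w. ?t w + ?t (- w)) has_sum E + E) ?A" by (rule has_sum_add[OF t t'])
    moreover have "((\<lambda>w. 6 * z\<^sup>2 * (1 / w ^ 4) + 2 * z ^ 4 * ?k w z) has_sum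
        6 * z\<^sup>2 * (\<Sum>\<^sub>\<infinity>w\<in>?A. 1 / w ^ 4) + 2 * z ^ 4 * K z) ?A"
      unfolding K_def using g_sum k_sum[of z] z
      by (intro has_sum_add has_sum_cmult_right has_sum_infsum) auto
    moreover have "?t w + ?t (- w) = 6 * z\<^sup>2 * (1 / w ^ 4) + 2 * z ^ 4 * ?k w z" if w: "w \<in> ?A" for w
    proof -
      have nz: "w \<noteq> 0" "w\<^sup>2 - z\<^sup>2 \<noteq> 0" using sq[OF w, of z] z w by auto
      have f: "w\<^sup>2 - z\<^sup>2 = - (z - w) * (z + w)" by (simp add: power2_eq_square algebra_simps)
      have nz': "z - w \<noteq> 0" "z + w \<noteq> 0" using nz(2) unfolding f by auto
      show ?thesis unfolding f using nz(1) nz'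
        by (simp add: divide_simps) (simp add: algebra_simps eval_nat_numeral)
    qed
    ultimately have "E + E = 6 * z\<^sup>2 * (\<Sum>\<^sub>\<infinity>w\<in>?A. 1 / w ^ 4) + 2 * z ^ 4 * K z"
      using has_sum_unique has_sum_cong by (metis (no_types, lifting))
    moreover have "E = (E + E) / 2" by simp
    ultimately have "E = 3 * (\<Sum>\<^sub>\<infinity>w\<in>?A. 1 / w ^ 4) * z\<^sup>2 + z ^ 4 * K z"
      by (simp only:) (simp add: field_simps)
    then show "wp L z = 1 / z\<^sup>2 + g2 L / 20 * z\<^sup>2 + z ^ 4 * K z"
      by (simp add: E_def g2_def algebra_simps)
  qed
  with that[OF \<rho> hol K0] show thesis by blast
qed

end

section \<open>Elliptic functions and differential equations\<close>

text \<open>The remainder is an exact factor \<open>M\<close>, continuous at 0, so limits at poles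
  can be found by algebra instead of estimates.\<close>

lemma taylor_remainder:
  fixes f :: "complex \<Rightarrow> complex"
  assumes "f analytic_on {b}"
  obtains M where "isCont M 0"
    "\<forall>\<^sub>F z in nhds 0. f (b + z) = (\<Sum>k<n. (deriv ^^ k) f b / fact k * z ^ k) + z ^ n * M z"
proof -
  define F where "F = fps_expansion f b"
  have F: "(\<lambda>z. f (b + z)) has_fps_expansion F"
    unfolding F_def by (rule analytic_at_imp_has_fps_expansion[OF assms])
  have nth: "fps_nth F k = (deriv ^^ k) f b / fact k" for k
    by (simp add: F_def fps_expansion_def)
  have rad: "fps_conv_radius F > 0" and ev: "\<forall>\<^sub>F z in nhds 0. eval_fps F z = f (b + z)"
    using F by (auto simp: has_fps_expansion_def)
  define M where "M = eval_fps (fps_shift n F)"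
  have "M has_fps_expansion fps_shift n F"
    unfolding M_def has_fps_expansion_def using rad by simp
  then have "isCont M 0" by (rule has_fps_expansion_imp_continuous)
  moreover have "\<forall>\<^sub>F z in nhds 0. z \<in> eball 0 (fps_conv_radius F)"
    using rad by (intro eventually_nhds_in_open) (auto simp: zero_ereal_def)
  then have "\<forall>\<^sub>F z in nhds 0. f (b + z) = (\<Sum>k<n. (deriv ^^ k) f b / fact k * z ^ k) + z ^ n * M z"
    using ev
  proof eventually_elim
    case (elim z)
    have sF: "summable (\<lambda>k. fps_nth F k * z ^ k)"
      using elim by (intro summable_fps) auto
    have sM: "summable (\<lambda>k. fps_nth (fps_shift n F) k * z ^ k)"
      using elim by (intro summable_fps) auto
    have "f (b + z) = (\<Sum>k. fps_nth F k * z ^ k)"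
      using elim by (simp add: eval_fps_def)
    also have "\<dots> = (\<Sum>k. fps_nth F (k + n) * z ^ (k + n)) + (\<Sum>k<n. fps_nth F k * z ^ k)"
      by (rule suminf_split_initial_segment[OF sF])
    also have "(\<Sum>k. fps_nth F (k + n) * z ^ (k + n)) = (\<Sum>k. z ^ n * (fps_nth (fps_shift n F) k * z ^ k))"
      by (simp add: power_add mult_ac)
    also have "\<dots> = z ^ n * M z"
      unfolding M_def eval_fps_def by (rule suminf_mult[OF sM])
    finally show ?case by (simp add: nth)
  qed
  ultimately show thesis using that by blast
qed

text \<open>The pattern of the computations at the origin: exhibit a function continuous at 0 that
  agrees with \<open>f\<close> off 0, and read off its value there.\<close>

lemma tendsto_at_0_cong:
  fixes f h :: "complex \<Rightarrow> complex"
  assumes "isCont h 0" "h 0 = c" "\<forall>\<^sub>F z in at 0. f z = h z"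
  shows "f \<midarrow>0\<rightarrow> c"
  using assms by (metis isContD tendsto_cong)

lemma eventually_nonzero: "\<forall>\<^sub>F z::complex in at 0. z \<noteq> 0"
  by (simp add: eventually_at_filter)

text \<open>The two derivative predicates coincide, so the choices made by \<open>deriv\<close>
  agree even at poles; \<open>elliptic_constant\<close> asks for periodicity at every point.\<close>

lemma deriv_periodic:
  fixes f :: "complex \<Rightarrow> complex"
  assumes "\<And>z. f (z + v) = f z"
  shows "deriv f (z + v) = deriv f z"
proof -
  have "(f has_field_derivative D) (at (z + v)) \<longleftrightarrow> (f has_field_derivative D) (at z)" for D
    using DERIV_shift[of f D z v] assms by simp
  then show ?thesis by (simp add: deriv_def)
qed

context complex_lattice
begin

lemma eventually_notin_shift: "\<forall>\<^sub>F z in at y. z - p \<notin> L"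
proof -
  obtain \<delta> where \<delta>: "\<delta> > 0" "\<And>w. w \<in> L \<Longrightarrow> w \<noteq> 0 \<Longrightarrow> norm w \<ge> \<delta>"
    using norm_lower_bound by blast
  have "\<forall>x\<in>L. \<forall>y\<in>L. dist y x < \<delta> \<longrightarrow> y = x"
    using \<delta>(2) diff_in by (fastforce simp: dist_norm)
  then have "\<not> (y - p) islimpt L"
    using \<delta>(1) discrete_imp_not_islimpt by blast
  then have "\<forall>\<^sub>F z in at (y - p). z \<notin> L" by (simp add: islimpt_iff_eventually)
  then have "\<forall>\<^sub>F z in filtermap (\<lambda>z. z - p) (at y). z \<notin> L"
    by (simp add: filtermap_at_shift)
  then show ?thesis by (simp add: eventually_filtermap)
qed

text \<open>Two classes of singularities, \<open>L\<close> and \<open>p + L\<close>, are allowed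
  because \<open>P (z + b)\<close> in the addition theorem adds poles on \<open>- b + L\<close>. The
  conclusion speaks of limits since the values of \<open>f\<close> at the singularities are
  artefacts of \<open>1 / 0 = 0\<close>.\<close>

lemma elliptic_constant:
  assumes periodic: "\<And>z v. v \<in> L \<Longrightarrow> f (z + v) = f z"
    and an: "\<And>z. z \<notin> L \<Longrightarrow> z - p \<notin> L \<Longrightarrow> f analytic_on {z}"
    and lim: "f \<midarrow>0\<rightarrow> c0" "f \<midarrow>p\<rightarrow> c1"
  obtains c where "\<And>z. f \<midarrow>z\<rightarrow> c"
proof -
  have shift_lim: "f \<midarrow>z + v\<rightarrow> c \<longleftrightarrow> f \<midarrow>z\<rightarrow> c" if "v \<in> L" for z v c
  proof -
    have "f \<midarrow>z + v\<rightarrow> c \<longleftrightarrow> (\<lambda>w. f (w + v)) \<midarrow>z\<rightarrow> c"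
      using LIM_offset[of f c "z + v" v] LIM_offset[of "\<lambda>w. f (w + v)" c z "- v"] by auto
    then show ?thesis using periodic[OF that] by simp
  qed
  have ex_lim: "\<exists>c. f \<midarrow>z\<rightarrow> c" for z
  proof -
    consider "z \<in> L" | "z - p \<in> L" | "z \<notin> L" "z - p \<notin> L" by blast
    then show ?thesis
    proof cases
      case 1
      then show ?thesis using shift_lim[where v = z and z = 0 and c = c0] lim(1) by auto
    next
      case 2
      then show ?thesis using shift_lim[where v = "z - p" and z = p and c = c1] lim(2) by auto
    next
      case 3
      then show ?thesis using an[of z] analytic_at_imp_isCont isContD by blast
    qed
  qed
  have isolated: "isolated_singularity_at f z" for z
    unfolding isolated_singularity_at_altdef
    using eventually_notin_shift[of 0 z] eventually_notin_shift[of p z]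
    by eventually_elim (use an in auto)
  define g where "g = remove_sings f"
  have "g analytic_on {z}" for z
    unfolding g_def using ex_lim isolated remove_sings_analytic_at by blast
  then have hol: "g holomorphic_on UNIV"
    by (meson analytic_imp_holomorphic analytic_on_analytic_at)
  have g: "f \<midarrow>z\<rightarrow> g z" for z
    using ex_lim[of z] remove_sings_eqI unfolding g_def by blast
  have g_periodic: "g (z + v) = g z" if "v \<in> L" for z v
    using shift_lim[OF that, where z = z] g[of "z + v"] g[of z] LIM_unique by blast
  obtain B where B: "\<And>z. \<exists>w\<in>L. norm (z - w) \<le> B" using cocompact by blast
  \<comment> \<open>By periodicity all values are taken on a compact disc, which yields the
    boundedness for Liouville's theorem.\<close>
  have "range g \<subseteq> g ` cball 0 B"
  proof
    fix y assume "y \<in> range g"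
    then obtain z where z: "y = g z" by blast
    obtain w where "w \<in> L" "norm (z - w) \<le> B" using B by blast
    then show "y \<in> g ` cball 0 B"
      using g_periodic[of w "z - w"] z by (intro image_eqI[of _ _ "z - w"]) auto
  qed
  moreover have "compact (g ` cball 0 B)"
    by (intro compact_continuous_image compact_cball holomorphic_on_imp_continuous_on
        holomorphic_on_subset[OF hol]) auto
  ultimately have "bounded (range g)" using compact_imp_bounded bounded_subset by blast
  then obtain c where "\<And>z. g z = c"
    using Liouville_theorem[OF hol] by (auto simp: constant_on_def)
  then show thesis using that g by metis
qed

section \<open>Laurent expansions at 0 and the differential equations\<close>

abbreviation "P \<equiv> wp L"
abbreviation "P' \<equiv> deriv (wp L)"
abbreviation "P'' \<equiv> deriv (deriv (wp L))"

lemma open_compl: "open (- L)"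
  using closed_L by auto

lemma P'_holomorphic: "P' holomorphic_on - L"
  by (rule holomorphic_deriv[OF wp_holomorphic open_compl])

lemma P''_holomorphic: "P'' holomorphic_on - L"
  by (rule holomorphic_deriv[OF P'_holomorphic open_compl])

lemma P_analytic:
  assumes "z \<notin> L"
  shows "P analytic_on {z}" "P' analytic_on {z}" "P'' analytic_on {z}"
  using assms open_compl wp_holomorphic P'_holomorphic P''_holomorphic
  by (auto simp: analytic_at)

lemma P_derivs:
  assumes "z \<notin> L"
  shows "(P has_field_derivative P' z) (at z)" "(P' has_field_derivative P'' z) (at z)"
  using holomorphic_derivI[OF wp_holomorphic open_compl] holomorphic_derivI[OF P'_holomorphic open_compl]
    assms by auto

lemma P'_periodic: "v \<in> L \<Longrightarrow> P' (z + v) = P' z"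
  by (rule deriv_periodic) (rule wp_periodic)

lemma P''_periodic: "v \<in> L \<Longrightarrow> P'' (z + v) = P'' z"
  by (rule deriv_periodic) (rule P'_periodic)

lemma P'_uminus:
  assumes "z \<notin> L"
  shows "P' (- z) = - P' z"
proof -
  have "((\<lambda>z. P (- z)) has_field_derivative P' (- z) * (- 1)) (at z)"
    by (rule DERIV_chain2[OF P_derivs(1)]) (use assms in \<open>auto intro!: derivative_eq_intros\<close>)
  then have "P' z = - P' (- z)"
    by (intro DERIV_imp_deriv) (simp add: wp_uminus)
  then show ?thesis by simp
qed

text \<open>\<open>K1\<close> and \<open>K2\<close> come from \<open>(z^4 K)' = z^3 K1\<close> and
  \<open>(z^3 K1)' = z^2 K2\<close>. The value \<open>K1 0 = 4 * K 0\<close> determines the constant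
  term in \<open>P'_squared\<close>.\<close>

lemma P_expansions:
  obtains K K1 K2 where "isCont K 0" "isCont K1 0" "isCont K2 0" "K 0 = g3 L / 28" "K1 0 = 4 * K 0"
    "\<forall>\<^sub>F z in at 0. P z = 1 / z\<^sup>2 + g2 L / 20 * z\<^sup>2 + z ^ 4 * K z \<and>
       P' z = - 2 / z ^ 3 + g2 L / 10 * z + z ^ 3 * K1 z \<and>
       P'' z = 6 / z ^ 4 + g2 L / 10 + z\<^sup>2 * K2 z"
proof -
  obtain K \<rho> where \<rho>: "\<rho> > 0" "K holomorphic_on ball 0 \<rho>" "K 0 = g3 L / 28"
    and P: "\<And>z. z \<in> ball 0 \<rho> - {0} \<Longrightarrow> z \<notin> L \<and> P z = 1 / z\<^sup>2 + g2 L / 20 * z\<^sup>2 + z ^ 4 * K z"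
    using wp_expansion by blast
  have hol': "deriv K holomorphic_on ball 0 \<rho>" by (rule holomorphic_deriv[OF \<rho>(2)]) simp
  have hol'': "deriv (deriv K) holomorphic_on ball 0 \<rho>" by (rule holomorphic_deriv[OF hol']) simp
  have cont: "isCont K 0" "isCont (deriv K) 0" "isCont (deriv (deriv K)) 0"
    using \<rho>(1) hol' hol'' \<rho>(2)
    by (auto simp: continuous_on_eq_continuous_at dest!: holomorphic_on_imp_continuous_on)
  have dK: "(K has_field_derivative deriv K z) (at z)"
      "(deriv K has_field_derivative deriv (deriv K) z) (at z)" if "z \<in> ball 0 \<rho>" for z
    using holomorphic_derivI[OF \<rho>(2)] holomorphic_derivI[OF hol'] that by auto
  define K1 where "K1 = (\<lambda>z. 4 * K z + z * deriv K z)"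
  define K2 where "K2 = (\<lambda>z. 12 * K z + 8 * z * deriv K z + z\<^sup>2 * deriv (deriv K) z)"
  have P': "P' z = - 2 / z ^ 3 + g2 L / 10 * z + z ^ 3 * K1 z" if z: "z \<in> ball 0 \<rho> - {0}" for z
  proof (rule DERIV_imp_deriv, rule has_field_derivative_transform_within_open[where S = "ball 0 \<rho> - {0}"])
    show "((\<lambda>z. 1 / z\<^sup>2 + g2 L / 20 * z\<^sup>2 + z ^ 4 * K z) has_field_derivative
        - 2 / z ^ 3 + g2 L / 10 * z + z ^ 3 * K1 z) (at z)"
    proof -
      have "((\<lambda>z. 1 / z\<^sup>2) has_field_derivative - 2 / z ^ 3) (at z)"
        using z by (auto intro!: derivative_eq_intros simp: eval_nat_numeral field_simps)
      moreover have "((\<lambda>z. g2 L / 20 * z\<^sup>2) has_field_derivative g2 L / 10 * z) (at z)"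
        by (auto intro!: derivative_eq_intros)
      moreover have "((\<lambda>z. z ^ 4 * K z) has_field_derivative z ^ 3 * K1 z) (at z)"
        using z by (auto intro!: derivative_eq_intros dK simp: K1_def algebra_simps eval_nat_numeral)
      ultimately show ?thesis by (intro DERIV_add)
    qed
  qed (use z P in auto)
  have P'': "P'' z = 6 / z ^ 4 + g2 L / 10 + z\<^sup>2 * K2 z" if z: "z \<in> ball 0 \<rho> - {0}" for z
  proof (rule DERIV_imp_deriv, rule has_field_derivative_transform_within_open[where S = "ball 0 \<rho> - {0}"])
    show "((\<lambda>z. - 2 / z ^ 3 + g2 L / 10 * z + z ^ 3 * K1 z) has_field_derivative
        6 / z ^ 4 + g2 L / 10 + z\<^sup>2 * K2 z) (at z)"
    proof -
      have "((\<lambda>z. - 2 / z ^ 3) has_field_derivative 6 / z ^ 4) (at z)"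
        using z by (auto intro!: derivative_eq_intros simp: eval_nat_numeral field_simps)
      moreover have "((\<lambda>z. g2 L / 10 * z) has_field_derivative g2 L / 10) (at z)"
        by (auto intro!: derivative_eq_intros)
      moreover have "((\<lambda>z. z ^ 3 * K1 z) has_field_derivative z\<^sup>2 * K2 z) (at z)"
        using z unfolding K1_def
        by (auto intro!: derivative_eq_intros dK simp: K2_def algebra_simps eval_nat_numeral)
      ultimately show ?thesis by (intro DERIV_add)
    qed
  qed (use z P' in auto)
  have "\<forall>\<^sub>F z in at 0. z \<in> ball 0 \<rho> - {0}"
    using \<rho>(1) by (intro eventually_at_in_open) auto
  then have "\<forall>\<^sub>F z in at 0. P z = 1 / z\<^sup>2 + g2 L / 20 * z\<^sup>2 + z ^ 4 * K z \<and>
       P' z = - 2 / z ^ 3 + g2 L / 10 * z + z ^ 3 * K1 z \<and>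
       P'' z = 6 / z ^ 4 + g2 L / 10 + z\<^sup>2 * K2 z"
    by eventually_elim (use P P' P'' in auto)
  moreover have "isCont K1 0" "isCont K2 0" unfolding K1_def K2_def
    by (intro continuous_intros cont)+
  ultimately show thesis using that[of K K1 K2] cont(1) \<rho>(3) by (simp add: K1_def)
qed

lemma elliptic_eq_limit_at_0:
  assumes an: "\<And>z. z \<notin> L \<Longrightarrow> f analytic_on {z}"
    and periodic: "\<And>z v. v \<in> L \<Longrightarrow> f (z + v) = f z"
    and lim: "f \<midarrow>0\<rightarrow> c" and z: "z \<notin> L"
  shows "f z = c"
proof -
  obtain d where d: "\<And>z. f \<midarrow>z\<rightarrow> d"
    by (rule elliptic_constant[OF periodic _ lim lim]) (use an in auto)
  have "f \<midarrow>z\<rightarrow> f z" using analytic_at_imp_isCont[OF an[OF z]] by (rule isContD)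
  then have "f z = d" using d LIM_unique by blast
  moreover have "d = c" using d lim LIM_unique by blast
  ultimately show ?thesis by simp
qed

text \<open>In \<open>P'' - 6 P^2\<close> the poles at 0 cancel, and the constant term is
  \<open>g2 / 10 - 12 g2 / 20 = - g2 / 2\<close>.\<close>

lemma P''_eq:
  assumes "z \<notin> L"
  shows "P'' z = 6 * (P z)\<^sup>2 - g2 L / 2"
proof -
  obtain K K1 K2 where cont: "isCont K 0" "isCont K1 0" "isCont K2 0"
    and ev: "\<forall>\<^sub>F z in at 0. P z = 1 / z\<^sup>2 + g2 L / 20 * z\<^sup>2 + z ^ 4 * K z \<and>
       P' z = - 2 / z ^ 3 + g2 L / 10 * z + z ^ 3 * K1 z \<and>
       P'' z = 6 / z ^ 4 + g2 L / 10 + z\<^sup>2 * K2 z"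
    using P_expansions by blast
  define h where "h z = - g2 L / 2 + z\<^sup>2 * (K2 z - 12 * K z - 6 * z\<^sup>2 * (g2 L / 20 + z\<^sup>2 * K z)\<^sup>2)" for z
  have "(\<lambda>z. P'' z - 6 * (P z)\<^sup>2) \<midarrow>0\<rightarrow> - g2 L / 2"
  proof (rule tendsto_at_0_cong)
    show "isCont h 0" unfolding h_def by (intro continuous_intros cont)
    show "h 0 = - g2 L / 2" by (simp add: h_def)
    show "\<forall>\<^sub>F z in at 0. P'' z - 6 * (P z)\<^sup>2 = h z"
      using ev eventually_nonzero
    proof eventually_elim
      case (elim z)
      define e where "e = g2 L / 20"
      have g: "g2 L = 20 * e" by (simp add: e_def)
      have P: "P z = (1 + e * z ^ 4 + z ^ 6 * K z) / z\<^sup>2"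
        using elim by (simp add: g field_simps eval_nat_numeral)
      have P2: "P'' z = (6 + 2 * e * z ^ 4 + z ^ 6 * K2 z) / z ^ 4"
        using elim by (simp add: g field_simps eval_nat_numeral)
      show ?case
        unfolding P P2 h_def g using elim
        by (simp add: divide_simps) (simp add: algebra_simps eval_nat_numeral)
    qed
  qed
  then have "P'' z - 6 * (P z)\<^sup>2 = - g2 L / 2"
    using assms
    by - (rule elliptic_eq_limit_at_0[where f = "\<lambda>z. P'' z - 6 * (P z)\<^sup>2"],
      auto intro!: analytic_intros P_analytic simp: P''_periodic wp_periodic)
  then show ?thesis by (simp add: algebra_simps)
qed

lemma P'_squared:
  assumes "z \<notin> L"
  shows "(P' z)\<^sup>2 = 4 * P z ^ 3 - g2 L * P z - g3 L"
proof -
  obtain K K1 K2 where cont: "isCont K 0" "isCont K1 0" "isCont K2 0"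
    and K0: "K 0 = g3 L / 28" "K1 0 = 4 * K 0"
    and ev: "\<forall>\<^sub>F z in at 0. P z = 1 / z\<^sup>2 + g2 L / 20 * z\<^sup>2 + z ^ 4 * K z \<and>
       P' z = - 2 / z ^ 3 + g2 L / 10 * z + z ^ 3 * K1 z \<and>
       P'' z = 6 / z ^ 4 + g2 L / 10 + z\<^sup>2 * K2 z"
    using P_expansions by blast
  define e where "e = g2 L / 20"
  have g: "g2 L = 20 * e" by (simp add: e_def)
  \<comment> \<open>The poles have cancelled in \<open>h\<close>. Its value at 0 is
    \<open>- 4 K1 0 - 12 K 0 = - 28 K 0 = - g3 L\<close>.\<close>
  define h where "h z = - 4 * K1 z - 12 * K z + 4 * e\<^sup>2 * z\<^sup>2 + 4 * e * z ^ 4 * K1 z + z ^ 6 * (K1 z)\<^sup>2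
    - 12 * z\<^sup>2 * (e + z\<^sup>2 * K z)\<^sup>2 - 4 * z ^ 6 * (e + z\<^sup>2 * K z) ^ 3
    + 20 * e * (e * z\<^sup>2 + z ^ 4 * K z)" for z
  have "(\<lambda>z. (P' z)\<^sup>2 - 4 * P z ^ 3 + g2 L * P z) \<midarrow>0\<rightarrow> - g3 L"
  proof (rule tendsto_at_0_cong)
    show "isCont h 0" unfolding h_def by (intro continuous_intros cont)
    show "h 0 = - g3 L" by (simp add: h_def K0)
    show "\<forall>\<^sub>F z in at 0. (P' z)\<^sup>2 - 4 * P z ^ 3 + g2 L * P z = h z"
      using ev eventually_nonzero
    proof eventually_elim
      case (elim z)
      have P: "P z = (1 + e * z ^ 4 + z ^ 6 * K z) / z\<^sup>2"
        using elim by (simp add: g field_simps eval_nat_numeral)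
      have P1: "P' z = (- 2 + 2 * e * z ^ 4 + z ^ 6 * K1 z) / z ^ 3"
        using elim by (simp add: g field_simps eval_nat_numeral)
      have "(P' z)\<^sup>2 - 4 * P z ^ 3 + g2 L * P z =
        ((- 2 + 2 * e * z ^ 4 + z ^ 6 * K1 z)\<^sup>2 - 4 * (1 + e * z ^ 4 + z ^ 6 * K z) ^ 3
          + 20 * e * z ^ 4 * (1 + e * z ^ 4 + z ^ 6 * K z)) / z ^ 6"
        unfolding P P1 g using elim by (simp add: field_simps eval_nat_numeral)
      also have "\<dots> = h z * z ^ 6 / z ^ 6"
        unfolding h_def by (rule arg_cong[of _ _ "\<lambda>t. t / z ^ 6"]) (simp add: algebra_simps eval_nat_numeral)
      finally show ?case using elim by simp
    qed
  qed
  then have "(P' z)\<^sup>2 - 4 * P z ^ 3 + g2 L * P z = - g3 L"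
    using assms
    by - (rule elliptic_eq_limit_at_0[where f = "\<lambda>z. (P' z)\<^sup>2 - 4 * P z ^ 3 + g2 L * P z"],
      auto intro!: analytic_intros P_analytic simp: P'_periodic wp_periodic)
  then show ?thesis by (simp add: algebra_simps)
qed

text \<open>Supplies the third-order Taylor coefficient of \<open>P\<close> at \<open>b\<close> for
  \<open>addition_lim_0\<close>.\<close>

lemma P'''_eq:
  assumes "z \<notin> L"
  shows "deriv P'' z = 12 * P z * P' z"
proof (rule DERIV_imp_deriv, rule has_field_derivative_transform_within_open[where S = "- L"])
  show "((\<lambda>z. 6 * (P z)\<^sup>2 - g2 L / 2) has_field_derivative 12 * P z * P' z) (at z)"
    by (auto intro!: derivative_eq_intros P_derivs assms)
qed (use assms open_compl P''_eq in auto)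

end

section \<open>The addition theorem\<close>

context complex_lattice
begin

text \<open>Each of the two terms has a pole of order 6 at 0; these cancel. Existence of a limit is
  enough, because the constant is identified at \<open>- b\<close> instead.\<close>

lemma addition_lim_0:
  assumes b: "b \<notin> L"
  obtains c where
    "(\<lambda>z. 4 * (P (z + b) + P z + P b) * (P z - P b)\<^sup>2 - (P' z - P' b)\<^sup>2) \<midarrow>0\<rightarrow> c"
proof -
  obtain K K1 K2 where cont: "isCont K 0" "isCont K1 0" "isCont K2 0"
    and ev: "\<forall>\<^sub>F z in at 0. P z = 1 / z\<^sup>2 + g2 L / 20 * z\<^sup>2 + z ^ 4 * K z \<and>
       P' z = - 2 / z ^ 3 + g2 L / 10 * z + z ^ 3 * K1 z \<and>
       P'' z = 6 / z ^ 4 + g2 L / 10 + z\<^sup>2 * K2 z"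
    using P_expansions by blast
  \<comment> \<open>The factor \<open>(P z - P b)^2\<close> has a pole of order 4, so
    \<open>P (b + z)\<close> is expanded up to a remainder \<open>z^4 M\<close>, whose contribution
    stays bounded.\<close>
  obtain M where contM: "isCont M 0" and evM: "\<forall>\<^sub>F z in nhds 0. P (b + z) =
      (\<Sum>k<4. (deriv ^^ k) P b / fact k * z ^ k) + z ^ 4 * M z"
    by (rule taylor_remainder[OF P_analytic(1)[OF b]])
  define e where "e = g2 L / 20"
  have g: "g2 L = 20 * e" by (simp add: e_def)
  define \<beta> \<gamma> where "\<beta> = P b" and "\<gamma> = P' b"
  have b2: "P'' b = 6 * \<beta>\<^sup>2 - 10 * e" and b3: "deriv P'' b = 12 * \<beta> * \<gamma>"
    using P''_eq[OF b] P'''_eq[OF b] by (simp_all add: \<beta>_def \<gamma>_def g)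
  have M: "P (b + z) = \<beta> + \<gamma> * z + (3 * \<beta>\<^sup>2 - 5 * e) * z\<^sup>2 + 2 * \<beta> * \<gamma> * z ^ 3 + z ^ 4 * M z"
    if "P (b + z) = (\<Sum>k<4. (deriv ^^ k) P b / fact k * z ^ k) + z ^ 4 * M z" for z
  proof -
    have "(\<Sum>k<4. (deriv ^^ k) P b / fact k * z ^ k) =
        P b + P' b * z + P'' b / 2 * z\<^sup>2 + deriv P'' b / 6 * z ^ 3"
      by (simp add: numeral_eq_Suc lessThan_Suc algebra_simps)
    also have "\<dots> = \<beta> + \<gamma> * z + (3 * \<beta>\<^sup>2 - 5 * e) * z\<^sup>2 + 2 * \<beta> * \<gamma> * z ^ 3"
      unfolding b2 b3 \<beta>_def \<gamma>_def by (simp add: field_simps)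
    finally show ?thesis using that by simp
  qed
  \<comment> \<open>\<open>A\<close>, \<open>v\<close> and \<open>V\<close> are the numerators,
    modulo \<open>z^6\<close>, of \<open>P (z + b) + P z + P b\<close>, \<open>P z - P b\<close> and
    \<open>P' z - P' b\<close> over \<open>z^2\<close>, \<open>z^2\<close> and
    \<open>z^3\<close>.\<close>
  define A where "A z = 1 + 2 * \<beta> * z\<^sup>2 + \<gamma> * z ^ 3 + (3 * \<beta>\<^sup>2 - 4 * e) * z ^ 4 + 2 * \<beta> * \<gamma> * z ^ 5" for z
  define v where "v z = 1 - \<beta> * z\<^sup>2 + e * z ^ 4" for z
  define V where "V z = - 2 - \<gamma> * z ^ 3 + 2 * e * z ^ 4" for z
  define R where "R z = - 16 * \<beta> ^ 3 + 40 * e * \<beta> - \<gamma>\<^sup>2 + z * (12 * e * \<gamma> - 12 * \<beta>\<^sup>2 * \<gamma>)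
    + z\<^sup>2 * (12 * \<beta> ^ 4 - 8 * e * \<beta>\<^sup>2 - 32 * e\<^sup>2) + z ^ 3 * (8 * \<beta> ^ 3 * \<gamma> + 8 * e * \<beta> * \<gamma>)
    + z ^ 4 * (40 * \<beta> * e\<^sup>2 - 24 * \<beta> ^ 3 * e) + z ^ 5 * (4 * \<gamma> * e\<^sup>2 - 16 * \<beta>\<^sup>2 * e * \<gamma>)
    + z ^ 6 * (12 * \<beta>\<^sup>2 - 16 * e) * e\<^sup>2 + z ^ 7 * 8 * \<beta> * \<gamma> * e\<^sup>2" for z
  define h where "h z = R z + 4 * (M z + K z) * (v z + z ^ 6 * K z)\<^sup>2
    + 4 * A z * K z * (2 * v z + z ^ 6 * K z) - K1 z * (2 * V z + z ^ 6 * K1 z)" for z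
  \<comment> \<open>The coefficients below \<open>z^6\<close> cancel thanks to the values of
    \<open>P'' b\<close> and \<open>P''' b\<close> built into \<open>A\<close>; \<open>R\<close> is
    the quotient.\<close>
  have R: "4 * A z * (v z)\<^sup>2 - (V z)\<^sup>2 = z ^ 6 * R z" for z
    unfolding A_def v_def V_def R_def by (simp add: algebra_simps eval_nat_numeral)
  have "isCont h 0"
    unfolding h_def R_def A_def v_def V_def by (intro continuous_intros cont contM)
  moreover have "\<forall>\<^sub>F z in at 0.
      4 * (P (z + b) + P z + P b) * (P z - P b)\<^sup>2 - (P' z - P' b)\<^sup>2 = h z"
    using ev eventually_nonzero evM[THEN filter_leD[OF at_within_le_nhds]]
  proof eventually_elim
    case (elim z)
    then have nz: "z \<noteq> 0" by simp
    have Pb: "P (z + b) + P z + P b = (A z + z ^ 6 * (M z + K z)) / z\<^sup>2"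
    proof -
      have Pz: "P z = 1 / z\<^sup>2 + e * z\<^sup>2 + z ^ 4 * K z" using elim by (simp add: g)
      show ?thesis
        unfolding add.commute[of z b] M[OF elim(3)] Pz A_def \<beta>_def[symmetric]
        using nz by (simp add: field_simps eval_nat_numeral)
    qed
    have Pm: "P z - P b = (v z + z ^ 6 * K z) / z\<^sup>2"
      using elim unfolding v_def
      by (simp add: g \<beta>_def[symmetric] field_simps eval_nat_numeral)
    have P'm: "P' z - P' b = (V z + z ^ 6 * K1 z) / z ^ 3"
      using elim unfolding V_def
      by (simp add: g \<gamma>_def[symmetric] field_simps eval_nat_numeral)
    have "4 * (P (z + b) + P z + P b) * (P z - P b)\<^sup>2 - (P' z - P' b)\<^sup>2 =
        (4 * (A z + z ^ 6 * (M z + K z)) * (v z + z ^ 6 * K z)\<^sup>2 - (V z + z ^ 6 * K1 z)\<^sup>2) / z ^ 6"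
      unfolding Pb Pm P'm using nz by (simp add: field_simps eval_nat_numeral)
    also have "4 * (A z + z ^ 6 * (M z + K z)) * (v z + z ^ 6 * K z)\<^sup>2 - (V z + z ^ 6 * K1 z)\<^sup>2 =
        (4 * A z * (v z)\<^sup>2 - (V z)\<^sup>2) + z ^ 6 * (h z - R z)"
      unfolding h_def by (simp add: algebra_simps power2_eq_square)
    also have "\<dots> = z ^ 6 * h z" unfolding R by (simp add: algebra_simps)
    finally show ?case using nz by simp
  qed
  ultimately have "(\<lambda>z. 4 * (P (z + b) + P z + P b) * (P z - P b)\<^sup>2 - (P' z - P' b)\<^sup>2)
      \<midarrow>0\<rightarrow> h 0"
    by (rule tendsto_at_0_cong[OF _ refl])
  then show thesis by (rule that)
qed

text \<open>At \<open>- b\<close> the double pole of \<open>P (z + b)\<close> meets a double zero of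
  \<open>(P z - P b)^2\<close>, as \<open>P\<close> is even. The limit is
  \<open>4 (P' b)^2 - (- 2 P' b)^2 = 0\<close>.\<close>

lemma addition_lim_uminus:
  assumes b: "b \<notin> L"
  shows "(\<lambda>z. 4 * (P (z + b) + P z + P b) * (P z - P b)\<^sup>2 - (P' z - P' b)\<^sup>2) \<midarrow>- b\<rightarrow> 0"
proof -
  obtain K K1 K2 where cont: "isCont K 0"
    and ev: "\<forall>\<^sub>F z in at 0. P z = 1 / z\<^sup>2 + g2 L / 20 * z\<^sup>2 + z ^ 4 * K z \<and>
       P' z = - 2 / z ^ 3 + g2 L / 10 * z + z ^ 3 * K1 z \<and>
       P'' z = 6 / z ^ 4 + g2 L / 10 + z\<^sup>2 * K2 z"
    using P_expansions by blast
  have b': "- b \<notin> L" using b by simp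
  define D where "D t = (P (- b + t) - P (- b)) / t" for t
  have D: "D \<midarrow>0\<rightarrow> - P' b"
    using P_derivs(1)[OF b'] P'_uminus[OF b] unfolding D_def by (simp add: DERIV_def)
  have lim1: "(\<lambda>t. P (- b + t)) \<midarrow>0\<rightarrow> P b"
    using isContD[OF analytic_at_imp_isCont[OF P_analytic(1)[OF b']]]
    by (simp add: LIM_offset_zero_iff wp_uminus)
  have lim2: "(\<lambda>t. P' (- b + t)) \<midarrow>0\<rightarrow> - P' b"
    using isContD[OF analytic_at_imp_isCont[OF P_analytic(2)[OF b']]]
    by (simp add: LIM_offset_zero_iff P'_uminus[OF b])
  define h where "h t = 4 * (D t)\<^sup>2 + 4 * (g2 L / 20 * t\<^sup>2 + t ^ 4 * K t + P (- b + t) + P b)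
    * (P (- b + t) - P b)\<^sup>2 - (P' (- b + t) - P' b)\<^sup>2" for t
  have "h \<midarrow>0\<rightarrow> 4 * (- P' b)\<^sup>2 + 4 * (g2 L / 20 * 0\<^sup>2 + 0 ^ 4 * K 0 + P b + P b)
    * (P b - P b)\<^sup>2 - (- P' b - P' b)\<^sup>2"
    unfolding h_def by (intro tendsto_intros D lim1 lim2 isContD[OF cont])
  then have h: "h \<midarrow>0\<rightarrow> 0" by (simp add: power2_eq_square)
  have "\<forall>\<^sub>F t in at 0. 4 * (P (- b + t + b) + P (- b + t) + P b) * (P (- b + t) - P b)\<^sup>2
      - (P' (- b + t) - P' b)\<^sup>2 = h t"
    using ev eventually_nonzero
  proof eventually_elim
    case (elim t)
    have "4 * (P (- b + t) - P b)\<^sup>2 / t\<^sup>2 = 4 * (D t)\<^sup>2"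
      by (simp add: D_def wp_uminus power_divide)
    then show ?case
      using elim unfolding h_def by (simp add: algebra_simps)
  qed
  then have "(\<lambda>t. 4 * (P (- b + t + b) + P (- b + t) + P b) * (P (- b + t) - P b)\<^sup>2
      - (P' (- b + t) - P' b)\<^sup>2) \<midarrow>0\<rightarrow> 0"
    using h by (simp only: tendsto_cong)
  then show ?thesis by (subst LIM_offset_zero_iff) simp_all
qed

lemma addition_theorem:
  assumes z: "z \<notin> L" and b: "b \<notin> L" and zb: "z + b \<notin> L"
  shows "4 * (P (z + b) + P z + P b) * (P z - P b)\<^sup>2 = (P' z - P' b)\<^sup>2"
proof -
  define f where "f z = 4 * (P (z + b) + P z + P b) * (P z - P b)\<^sup>2 - (P' z - P' b)\<^sup>2" for z
  obtain c where lim0: "f \<midarrow>0\<rightarrow> c" using addition_lim_0[OF b] unfolding f_def by blast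
  have limb: "f \<midarrow>- b\<rightarrow> 0" using addition_lim_uminus[OF b] unfolding f_def .
  have an: "f analytic_on {z}" if "z \<notin> L" "z - - b \<notin> L" for z
  proof -
    have "P \<circ> (\<lambda>z. z + b) analytic_on {z}"
      using that by (intro analytic_on_compose) (auto intro!: analytic_intros P_analytic)
    then have "(\<lambda>z. P (z + b)) analytic_on {z}" by (simp add: o_def)
    then show ?thesis unfolding f_def using that by (intro analytic_intros P_analytic)
  qed
  have per: "f (z + v) = f z" if "v \<in> L" for z v
  proof -
    have "z + v + b = z + b + v" by simp
    then show ?thesis unfolding f_def by (simp only: wp_periodic P'_periodic that)
  qed
  obtain d where d: "\<And>z. f \<midarrow>z\<rightarrow> d"
    using elliptic_constant[OF per an lim0 limb] by blast
  have "d = 0" using d limb LIM_unique by blast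
  moreover have "f z = d"
    using analytic_at_imp_isCont[OF an[OF z]] zb d LIM_unique isContD by fastforce
  ultimately show ?thesis by (simp add: f_def)
qed

end

section \<open>Values at torsion points\<close>

text \<open>For points of order 2, whose values under \<open>wp\<close> are roots of this
  cubic.\<close>

lemma integral_over_cubic_root:
  assumes root: "x ^ 3 - h2 * x - h3 = 0" and k: "k > 0"
  shows "integral_over (int_poly2_ring h2 h3) (of_nat k * x)"
proof (rule integral_over_of_root)
  let ?p = "[: - h3, - h2, 0, 1 :]"
  have "coeff ?p i \<in> int_poly2_ring h2 h3" for i
    by (auto simp: coeff_pCons split: nat.split intro: int_poly2_ring_minus
        int_poly2_ring_gens int_poly2_ring_0 int_poly2_ring_1)
  moreover have "degree ?p \<le> 3" "coeff ?p 3 = 1"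
    by (simp_all add: numeral_3_eq_3)
  ultimately show "top_coeff h2 h3 ?p 3 (of_nat 1)" by (simp add: top_coeff_def)
  show "poly ?p x = 0" using root by (simp add: algebra_simps power3_eq_cube)
qed (use k in auto)

context complex_lattice
begin

section \<open>Fibres and critical points of the Weierstrass function\<close>

lemma countable_L: "countable L"
proof -
  have "L \<subseteq> (\<Union>n::nat. {w \<in> L. norm w \<le> of_nat n})"
    using real_arch_simple by blast
  moreover have "countable (\<Union>n::nat. {w \<in> L. norm w \<le> of_nat n})"
    by (rule countable_UN) (auto intro: countable_finite finite_bounded)
  ultimately show ?thesis by (rule countable_subset)
qed

lemma connected_compl: "connected (- L)"
  using connected_open_diff_countable[of "UNIV :: complex set" L] countable_L connected_UNIV
  by (simp add: Compl_eq_Diff_UNIV)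

text \<open>If \<open>P'\<close> vanished off \<open>L\<close>, then so would
  \<open>z^3 P' z\<close>, which tends to -2 at 0.\<close>

lemma P'_nonzero: "\<exists>z. z \<notin> L \<and> P' z \<noteq> 0"
proof (rule ccontr)
  assume "\<not> (\<exists>z. z \<notin> L \<and> P' z \<noteq> 0)"
  then have zero: "P' z = 0" if "z \<notin> L" for z using that by blast
  obtain K K1 K2 where cont: "isCont K1 0"
    and ev: "\<forall>\<^sub>F z in at 0. P z = 1 / z\<^sup>2 + g2 L / 20 * z\<^sup>2 + z ^ 4 * K z \<and>
       P' z = - 2 / z ^ 3 + g2 L / 10 * z + z ^ 3 * K1 z \<and>
       P'' z = 6 / z ^ 4 + g2 L / 10 + z\<^sup>2 * K2 z"
    using P_expansions by blast
  define h where "h z = - 2 + g2 L / 10 * z ^ 4 + z ^ 6 * K1 z" for z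
  have "(\<lambda>z::complex. 0) \<midarrow>0\<rightarrow> (- 2 :: complex)"
  proof (rule tendsto_at_0_cong)
    show "isCont h 0" unfolding h_def by (intro continuous_intros cont)
    show "h 0 = - 2" by (simp add: h_def)
    show "\<forall>\<^sub>F z in at 0. 0 = h z"
      using ev eventually_nonzero eventually_notin_shift[of 0 0]
    proof eventually_elim
      case (elim z)
      then have "0 = (- 2 / z ^ 3 + g2 L / 10 * z + z ^ 3 * K1 z) * z ^ 3"
        using zero[of z] by simp
      also have "\<dots> = h z"
        using elim unfolding h_def by (simp add: field_simps eval_nat_numeral)
      finally show ?case .
    qed
  qed
  then show False using LIM_unique[OF tendsto_const] by fastforce
qed

lemma P_not_constant: "\<not> P constant_on - L"
proof
  assume "P constant_on - L"
  then obtain c where c: "\<And>z. z \<in> - L \<Longrightarrow> P z = c" by (auto simp: constant_on_def)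
  have "P' z = 0" if "z \<notin> L" for z
    by (rule DERIV_imp_deriv, rule has_field_derivative_transform_within_open[where S = "- L" and f = "\<lambda>_. c"])
       (use c that open_compl in auto)
  then show False using P'_nonzero by blast
qed

text \<open>The addition theorem for \<open>(a, b)\<close> and for \<open>(a, - b)\<close> has left
  side 0 here, which gives both \<open>P' a = P' b\<close> and \<open>P' a = - P' b\<close>.\<close>

lemma P_eq_imp_critical:
  assumes "a \<notin> L" "b \<notin> L" "a + b \<notin> L" "a - b \<notin> L" "P a = P b"
  shows "P' b = 0"
proof -
  have "(P' a - P' b)\<^sup>2 = 0"
    using addition_theorem[of a b] assms by simp
  moreover have "(P' a + P' b)\<^sup>2 = 0"
    using addition_theorem[of a "- b"] assms by (simp add: wp_uminus P'_uminus)
  ultimately show ?thesis by simp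
qed

text \<open>A coincidence of values outside \<open>\<plusminus>b + L\<close> would force a critical point at \<open>b\<close>; by the
  open mapping theorem it would persist for all points near \<open>b\<close>, but critical points are isolated.\<close>

lemma P_eq_iff:
  assumes a: "a \<notin> L" and b: "b \<notin> L"
  shows "P a = P b \<longleftrightarrow> a + b \<in> L \<or> a - b \<in> L"
proof
  assume "a + b \<in> L \<or> a - b \<in> L"
  then show "P a = P b"
  proof
    assume "a + b \<in> L"
    then show ?thesis using wp_periodic[of "a + b" "- b"] by (simp add: wp_uminus)
  next
    assume "a - b \<in> L"
    then show ?thesis using wp_periodic[of "a - b" b] by simp
  qed
next
  assume eq: "P a = P b"
  show "a + b \<in> L \<or> a - b \<in> L"
  proof (rule ccontr)
    assume "\<not> (a + b \<in> L \<or> a - b \<in> L)"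
    then have ab: "a + b \<in> - L" "a - b \<in> - L" by auto
    obtain r1 where r1: "r1 > 0" "ball (a + b) r1 \<subseteq> - L" using open_compl ab open_contains_ball by blast
    obtain r2 where r2: "r2 > 0" "ball (a - b) r2 \<subseteq> - L" using open_compl ab open_contains_ball by blast
    obtain r3 where r3: "r3 > 0" "ball a r3 \<subseteq> - L" using open_compl a open_contains_ball by blast
    obtain z where z: "z \<notin> L" "P' z \<noteq> 0" using P'_nonzero by blast
    have "P' b = 0" using P_eq_imp_critical[of a b] a b ab eq by auto
    then obtain r4 where r4: "r4 > 0" "ball b r4 \<subseteq> - L" "\<And>z. z \<in> ball b r4 - {b} \<Longrightarrow> P' z \<noteq> 0"
      using isolated_zeros[OF P'_holomorphic open_compl connected_compl, of b z] b z by auto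
    \<comment> \<open>The halves are needed because \<open>a' + b'\<close> and
      \<open>a' - b'\<close> can move by up to twice \<open>\<epsilon>\<close> when
      \<open>a'\<close> and \<open>b'\<close> each move by less than
      \<open>\<epsilon>\<close>.\<close>
    define \<epsilon> where "\<epsilon> = min (min (r1 / 2) (r2 / 2)) (min r3 r4)"
    have \<epsilon>: "\<epsilon> > 0" "2 * \<epsilon> \<le> r1" "2 * \<epsilon> \<le> r2" "\<epsilon> \<le> r3" "\<epsilon> \<le> r4"
      using r1 r2 r3 r4 by (auto simp: \<epsilon>_def)
    have "open (P ` ball a \<epsilon>)"
      using r3 \<epsilon> by (intro open_mapping_thm[OF wp_holomorphic open_compl connected_compl _ _ P_not_constant])
        (auto simp: subset_iff)
    moreover have "P b \<in> P ` ball a \<epsilon>" using eq \<epsilon>(1) by (intro image_eqI[of _ _ a]) auto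
    moreover have "P \<midarrow>b\<rightarrow> P b"
      using analytic_at_imp_isCont[OF P_analytic(1)[OF b]] by (rule isContD)
    ultimately have "\<forall>\<^sub>F y in at b. P y \<in> P ` ball a \<epsilon>" using topological_tendstoD by blast
    moreover have "\<forall>\<^sub>F y in at b. y \<in> ball b \<epsilon> - {b}"
      using \<epsilon>(1) by (intro eventually_at_in_open) auto
    ultimately have "\<forall>\<^sub>F y in at b. P y \<in> P ` ball a \<epsilon> \<and> y \<in> ball b \<epsilon> - {b}"
      by (rule eventually_conj)
    then obtain b' where b': "P b' \<in> P ` ball a \<epsilon>" "b' \<in> ball b \<epsilon> - {b}"
      using eventually_happens'[OF at_neq_bot] by blast
    then obtain a' where a': "a' \<in> ball a \<epsilon>" "P a' = P b'" by auto
    have "dist (a + b) (a' + b') < \<epsilon> + \<epsilon>" "dist (a - b) (a' - b') < \<epsilon> + \<epsilon>"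
      using a'(1) b'(2) norm_triangle_ineq[of "a - a'" "b - b'"] norm_triangle_ineq4[of "a - a'" "b - b'"]
      by (auto simp: dist_norm algebra_simps)
    then have "a' + b' \<in> ball (a + b) r1" "a' - b' \<in> ball (a - b) r2" "a' \<in> ball a r3" "b' \<in> ball b r4 - {b}"
      using a' b' \<epsilon> by auto
    moreover from this have "a' + b' \<notin> L" "a' - b' \<notin> L" "a' \<notin> L" "b' \<notin> L"
      using r1(2) r2(2) r3(2) r4(2) by blast+
    ultimately show False
      using P_eq_imp_critical[of a' b'] a'(2) r4(3) by blast
  qed
qed

text \<open>Near \<open>u\<close> the map \<open>P\<close> is injective: equal values at
  \<open>x\<close> and \<open>y\<close> put \<open>x + y\<close> into \<open>L\<close>, excluded
  near \<open>2 * u\<close>, or \<open>x - y\<close>, which is too short unless 0. An injective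
  holomorphic map has nonzero derivative.\<close>

lemma P'_nonzero_at:
  assumes u: "u \<notin> L" "2 * u \<notin> L"
  shows "P' u \<noteq> 0"
proof -
  obtain \<delta> where \<delta>: "\<delta> > 0" "\<And>w. w \<in> L \<Longrightarrow> w \<noteq> 0 \<Longrightarrow> norm w \<ge> \<delta>"
    using norm_lower_bound by blast
  obtain r1 where r1: "r1 > 0" "ball u r1 \<subseteq> - L"
    using open_compl u(1) open_contains_ball by blast
  obtain r2 where r2: "r2 > 0" "ball (2 * u) r2 \<subseteq> - L"
    using open_compl u(2) open_contains_ball by blast
  define r where "r = min (\<delta> / 2) (min r1 (r2 / 2))"
  have r: "r > 0" "2 * r \<le> \<delta>" "r \<le> r1" "2 * r \<le> r2" using \<delta> r1 r2 by (auto simp: r_def)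
  have sub: "ball u r \<subseteq> - L" using r1 r by (auto simp: subset_iff)
  have "inj_on P (ball u r)"
  proof (rule inj_onI)
    fix x y assume xy: "x \<in> ball u r" "y \<in> ball u r" "P x = P y"
    have "norm (2 * u - (x + y)) \<le> norm (u - x) + norm (u - y)" "norm (x - y) \<le> norm (u - y) + norm (u - x)"
      using norm_triangle_ineq[of "u - x" "u - y"] norm_triangle_ineq4[of "u - y" "u - x"]
      by (simp_all add: algebra_simps mult_2)
    moreover have "norm (u - x) < r" "norm (u - y) < r" using xy by (auto simp: dist_norm)
    ultimately have n: "norm (2 * u - (x + y)) < 2 * r" "norm (x - y) < 2 * r" by linarith+
    then have "x + y \<notin> L" using r2 r by (auto simp: subset_iff dist_norm)
    moreover have "x \<notin> L" "y \<notin> L" using xy sub by blast+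
    ultimately have "x - y \<in> L" using P_eq_iff[of x y] xy by simp
    then show "x = y" using \<delta>(2)[of "x - y"] n r by fastforce
  qed
  then show ?thesis
    using holomorphic_injective_imp_regular[OF holomorphic_on_subset[OF wp_holomorphic sub]] r(1) by simp
qed

text \<open>The limit of the addition theorem for \<open>u\<close> and \<open>u + h\<close>, divided
  by \<open>h^2\<close>, as \<open>h\<close> tends to 0. The differential equations then eliminate
  \<open>P'' u\<close> and \<open>P' u\<close> from the right side.\<close>

lemma duplication:
  assumes u: "u \<notin> L" "2 * u \<notin> L"
  shows "(P (2 * u) - t) * (P' u)\<^sup>2 = biquad (g2 L / 4) (g3 L / 4) t (P u) (P u)"
proof -
  have D: "(\<lambda>h. (P (u + h) - P u) / h) \<midarrow>0\<rightarrow> P' u" "(\<lambda>h. (P' (u + h) - P' u) / h) \<midarrow>0\<rightarrow> P'' u"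
    using P_derivs[OF u(1)] by (simp_all add: DERIV_def)
  have c: "(\<lambda>h. P (2 * u + h)) \<midarrow>0\<rightarrow> P (2 * u)" "(\<lambda>h. P (u + h)) \<midarrow>0\<rightarrow> P u"
    using isContD[OF analytic_at_imp_isCont[OF P_analytic(1)[OF u(2)]]]
      isContD[OF analytic_at_imp_isCont[OF P_analytic(1)[OF u(1)]]]
    by (simp_all add: LIM_offset_zero_iff)
  have l: "(\<lambda>h. 4 * (P (2 * u + h) + P u + P (u + h)) * ((P (u + h) - P u) / h)\<^sup>2) \<midarrow>0\<rightarrow>
      4 * (P (2 * u) + P u + P u) * (P' u)\<^sup>2"
    by (intro tendsto_intros D c)
  have r: "(\<lambda>h. ((P' (u + h) - P' u) / h)\<^sup>2) \<midarrow>0\<rightarrow> (P'' u)\<^sup>2"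
    by (intro tendsto_intros D)
  have ev: "\<forall>\<^sub>F h in at 0. 4 * (P (2 * u + h) + P u + P (u + h)) * ((P (u + h) - P u) / h)\<^sup>2
      = ((P' (u + h) - P' u) / h)\<^sup>2"
    using eventually_notin_shift[of "- u" 0] eventually_notin_shift[of "- (2 * u)" 0] eventually_nonzero
  proof eventually_elim
    case (elim h)
    have "4 * (P (2 * u + h) + P u + P (u + h)) * (P (u + h) - P u)\<^sup>2 = (P' (u + h) - P' u)\<^sup>2"
      using addition_theorem[of u "u + h"] elim u
      by (simp add: algebra_simps mult_2 power2_commute)
    then show ?case using elim by (simp add: power_divide field_simps)
  qed
  have "4 * (P (2 * u) + P u + P u) * (P' u)\<^sup>2 = (P'' u)\<^sup>2"
    by (rule LIM_unique[OF l tendsto_cong[OF ev, THEN iffD2, OF r]])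
  then have eq: "(P (2 * u) - t) * (P' u)\<^sup>2 = (P'' u)\<^sup>2 / 4 - (2 * P u + t) * (P' u)\<^sup>2"
    by (simp add: algebra_simps)
  show ?thesis
    unfolding eq unfolding P''_eq[OF u(1)] P'_squared[OF u(1)] biquad_def
    by (simp add: field_simps eval_nat_numeral)
qed

text \<open>Replacing \<open>b\<close> by \<open>- b\<close> changes the sign of
  \<open>P' b\<close>. In the product of the two addition formulas the derivatives therefore occur
  only squared, and the cubic eliminates them, leaving a multiple of \<open>16 d^2\<close>.\<close>

lemma sum_difference_product:
  assumes ab: "a \<notin> L" "b \<notin> L" "a + b \<notin> L" "a - b \<notin> L"
  shows "(P (a + b) - t) * (P (a - b) - t) * (P a - P b)\<^sup>2 = biquad (g2 L / 4) (g3 L / 4) t (P a) (P b)"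
proof -
  define x y x' y' d where "x = P a" and "y = P' a" and "x' = P b" and "y' = P' b" and "d = x - x'"
  define h2 h3 where "h2 = g2 L / 4" and "h3 = g3 L / 4"
  define c where "c = 4 * (x + x' + t) * d\<^sup>2"
  have d: "d \<noteq> 0" using P_eq_iff[of a b] ab by (simp add: d_def x_def x'_def)
  have y: "y\<^sup>2 = 4 * x ^ 3 - 4 * h2 * x - 4 * h3" "y'\<^sup>2 = 4 * x' ^ 3 - 4 * h2 * x' - 4 * h3"
    using P'_squared ab by (simp_all add: x_def y_def x'_def y'_def h2_def h3_def)
  define X Y where "X = P (a + b) - t" and "Y = P (a - b) - t"
  have s: "4 * X * d\<^sup>2 = (y - y')\<^sup>2 - c"
    using addition_theorem[of a b] ab unfolding c_def
    by (simp add: X_def x_def y_def x'_def y'_def d_def algebra_simps)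
  have r: "4 * Y * d\<^sup>2 = (y + y')\<^sup>2 - c"
    using addition_theorem[of a "- b"] ab unfolding c_def
    by (simp add: Y_def x_def y_def x'_def y'_def d_def wp_uminus P'_uminus algebra_simps)
  have "16 * d\<^sup>2 * (X * Y * d\<^sup>2) = ((y - y')\<^sup>2 - c) * ((y + y')\<^sup>2 - c)"
    unfolding s[symmetric] r[symmetric] by (simp add: power2_eq_square)
  also have "\<dots> = (y\<^sup>2 - y'\<^sup>2)\<^sup>2 - 2 * c * (y\<^sup>2 + y'\<^sup>2) + c\<^sup>2"
    by (simp add: power2_eq_square algebra_simps)
  also have "\<dots> = 16 * d\<^sup>2 * biquad h2 h3 t x x'"
    unfolding y c_def d_def biquad_def by (simp add: algebra_simps eval_nat_numeral)
  finally have "X * Y * d\<^sup>2 = biquad h2 h3 t x x'"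
    using d by simp
  then show ?thesis by (simp only: X_def Y_def x_def x'_def d_def h2_def h3_def)
qed

lemma integral_division_value:
  assumes m: "m > 0" and u: "u \<notin> L" and mu: "of_nat m * u \<in> L"
  shows "integral_over (int_poly2_ring (g2 L / 4) (g3 L / 4)) (of_nat m * P u)"
    and "even m \<Longrightarrow> integral_over (int_poly2_ring (g2 L / 4) (g3 L / 4)) (of_nat (m div 2) * P u)"
proof -
  define h2 h3 where "h2 = g2 L / 4" and "h3 = g3 L / 4"
  define N where "N = (LEAST n. n > 0 \<and> of_nat n * u \<in> L)"
  have N: "N > 0" "of_nat N * u \<in> L"
    using LeastI[of "\<lambda>n. n > 0 \<and> of_nat n * u \<in> L" m] m mu by (auto simp: N_def)
  have minimal: "of_nat n * u \<notin> L" if "0 < n" "n < N" for n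
    using not_less_Least[of n "\<lambda>n. n > 0 \<and> of_nat n * u \<in> L"] that by (auto simp: N_def)
  have "N \<noteq> 1" using N u by auto
  have dvd: "N dvd m"
  proof (rule ccontr)
    assume "\<not> N dvd m"
    then have "0 < m mod N" "m mod N < N" using N by (auto simp: dvd_eq_mod_eq_0)
    moreover have "of_nat m * u = of_nat (m mod N) * u + of_nat (m div N) * (of_nat N * u)"
      by (subst mod_div_mult_eq[of m N, symmetric]) (simp only: of_nat_add of_nat_mult algebra_simps)
    ultimately show False
      using minimal mu add_in_iff[OF of_nat_mult_in[OF N(2)]] by metis
  qed
  have curve: "(P' u)\<^sup>2 = 4 * (P u ^ 3 - h2 * P u - h3)"
    using P'_squared[OF u] by (simp add: h2_def h3_def)
  have "integral_over (int_poly2_ring h2 h3) (of_nat m * P u) \<and>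
    (even m \<longrightarrow> integral_over (int_poly2_ring h2 h3) (of_nat (m div 2) * P u))"
  proof (cases "N = 2")
    case True
    \<comment> \<open>Here \<open>2 * u\<close> is a period and \<open>P'\<close> is odd, so
      \<open>P' u = 0\<close> and \<open>P u\<close> is a root of the cubic.\<close>
    then have "P' u = P' (- u)"
      using P'_periodic[of "2 * u" "- u"] N by simp
    then have "P' u = 0" using P'_uminus[OF u] by simp
    then have "4 * (P u ^ 3 - h2 * P u - h3) = 0" using curve by simp
    then have "P u ^ 3 - h2 * P u - h3 = 0" by (simp only: mult_eq_0_iff) simp
    then have "integral_over (int_poly2_ring h2 h3) (of_nat k * P u)" if "k > 0" for k
      using that by (rule integral_over_cubic_root)
    moreover have "m div 2 > 0" if even: "even m"
    proof -
      obtain c where "m = 2 * c" using even by (elim evenE)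
      then show ?thesis using m by simp
    qed
    ultimately show ?thesis using m by blast
  next
    case False
    then have N3: "N \<ge> 3" using N \<open>N \<noteq> 1\<close> by linarith
    have "torsion_abscissae N (\<lambda>n. P (of_nat n * u)) (P' u) h2 h3"
    proof (rule torsion_abscissae.intro)
      show "N \<ge> 3" by (rule N3)
      have u2: "2 * u \<notin> L" using minimal[of 2] N3 by simp
      then show "P' u \<noteq> 0" by (rule P'_nonzero_at[OF u])
      show "(P (of_nat 2 * u) - t) * (P' u)\<^sup>2 = biquad h2 h3 t (P (of_nat 1 * u)) (P (of_nat 1 * u))" for t
        using duplication[OF u u2] by (simp add: h2_def h3_def)
      show "(P' u)\<^sup>2 = 4 * (P (of_nat 1 * u) ^ 3 - h2 * P (of_nat 1 * u) - h3)"
        using curve by simp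
      have "of_nat (N - 1) * u = - u + of_nat N * u"
        using N by (simp add: of_nat_diff algebra_simps)
      then show "P (of_nat (N - 1) * u) = P (of_nat 1 * u)"
        by (simp only: wp_periodic[OF N(2)] wp_uminus of_nat_1 mult_1)
      fix p q :: nat assume pq: "1 \<le> q" "q < p" "p + q < N"
      have eqs: "of_nat p * u + of_nat q * u = of_nat (p + q) * u"
          "of_nat p * u - of_nat q * u = of_nat (p - q) * u"
        using pq by (simp_all add: of_nat_diff distrib_right left_diff_distrib)
      \<comment> \<open>The locale's range conditions put \<open>p\<close>, \<open>q\<close>,
        \<open>p + q\<close> and \<open>p - q\<close> strictly between 0 and \<open>N\<close>, where
        minimality of \<open>N\<close> applies.\<close>
      have notin: "of_nat p * u \<notin> L" "of_nat q * u \<notin> L" "of_nat p * u + of_nat q * u \<notin> L"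
          "of_nat p * u - of_nat q * u \<notin> L"
        unfolding eqs by (rule minimal; use pq in linarith)+
      show "P (of_nat p * u) \<noteq> P (of_nat q * u)"
        by (simp only: P_eq_iff[OF notin(1,2)] notin(3,4) simp_thms not_False_eq_True)
      show "(P (of_nat (p + q) * u) - t) * (P (of_nat (p - q) * u) - t) *
          (P (of_nat p * u) - P (of_nat q * u))\<^sup>2 = biquad h2 h3 t (P (of_nat p * u)) (P (of_nat q * u))" for t
        using sum_difference_product[OF notin] by (simp only: eqs h2_def h3_def)
    qed
    from torsion_abscissae.integral_multiple[OF this dvd m] show ?thesis by simp
  qed
  then show "integral_over (int_poly2_ring (g2 L / 4) (g3 L / 4)) (of_nat m * P u)"
    and "even m \<Longrightarrow> integral_over (int_poly2_ring (g2 L / 4) (g3 L / 4)) (of_nat (m div 2) * P u)"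
    unfolding h2_def h3_def by blast+
qed

end

theorem mainTheorem17:
  fixes L :: "complex set" and m :: nat and u :: complex
  assumes "is_lattice L"
    and "m > 0"
    and "u \<notin> L"
    and "of_nat m * u \<in> L"
  shows "integral_over (int_poly2_ring (g2 L / 4) (g3 L / 4)) (of_nat m * wp L u)
       \<and> (even m \<longrightarrow>
            integral_over (int_poly2_ring (g2 L / 4) (g3 L / 4)) (of_nat m / 2 * wp L u))"
proof -
  interpret complex_lattice L by standard (rule assms(1))
  have "of_nat m / 2 = (of_nat (m div 2) :: complex)" if "even m"
    using that by (auto elim!: evenE)
  then show ?thesis using integral_division_value[OF assms(2-4)] by simp
qed

end
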